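(* Let $p\ge1$ be an integer, let $H=\mathrm{diag}(H_1,\dots,H_p)$ with $0<H_i<1$ for $i=1,\dots,p$, let $A_+=(a^+_{ij})$ and $A_-=(a^-_{ij})$ be real $p\times p$ matrices, and let $X=\{X(t)=(X_1(t),\dots,X_p(t)),\ t\in\mathbb{R}\}$ be the process defined by $$X(t)=\int_{\mathbb{R}}\left\{\left((t-x)_+^{H-.5}-(-x)_+^{H-.5}\right)A_++\left((t-x)_-^{H-.5}-(-x)_-^{H-.5}\right)A_-\right\}W(\mathrm{d}x),$$ where $W(\mathrm{d}x)=(W_1(\mathrm{d}x),\dots,W_p(\mathrm{d}x))$ is a Gaussian white noise on $\mathbb{R}$ with zero mean, independent components and covariance $\mathrm{E}\,W_i(\mathrm{d}x)W_j(\mathrm{d}x)=\delta_{ij}\,\mathrm{d}x$. Put $$\alpha^{++}_{ij}:=\sum_{k=1}^p a^+_{ik}a^+_{jk},\quad \alpha^{--}_{ij}:=\sum_{k=1}^p a^-_{ik}a^-_{jk},\quad \alpha^{+-}_{ij}:=\sum_{k=1}^p a^+_{ik}a^-_{jk},\quad \alpha^{-+}_{ij}:=\sum_{k=1}^p a^-_{ik}a^+_{jk},$$ and let $\sigma_i\ge 0$ with $\sigma_i^2:=\mathrm{var}(X_i(1))$. Then the following hold for $i,j\in\{1,\dots,p\}$. (i) For any $i$, the variance of $X_i(1)$ is $$\sigma_i^2=\frac{B(H_i+.5,\,H_i+.5)}{\sin(H_i\pi)}\left\{\alpha^{++}_{ii}+\alpha^{--}_{ii}-2\sin(H_i\pi)\,\alpha^{+-}_{ii}\right\}.$$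 (ii) If $H_i+H_j\neq1$, then for any $s,t\in\mathbb{R}$, $$\mathrm{E}\,X_i(s)X_j(t)=\frac{\sigma_i\sigma_j}{2}\left\{c_{ij}(s)|s|^{H_i+H_j}+c_{ji}(t)|t|^{H_i+H_j}-c_{ji}(t-s)|t-s|^{H_i+H_j}\right\},$$ where $c_{ij}(u):=c_{ij}$ for $u>0$ and $c_{ij}(u):=c_{ji}$ for $u<0$ (and likewise with $i,j$ exchanged), and $c_{ij}$ is given by $$\frac{\sigma_i\sigma_j}{2}c_{ij}=\frac{B(H_i+.5,\,H_j+.5)}{\sin((H_i+H_j)\pi)}\left\{\alpha^{++}_{ij}\cos(H_i\pi)+\alpha^{--}_{ij}\cos(H_j\pi)-\alpha^{+-}_{ij}\sin((H_i+H_j)\pi)\right\},$$ with $c_{ji}$ given by the same formula with $i$ and $j$ exchanged. (iii) If $H_i+H_j=1$, then for any $s,t\in\mathbb{R}$, $$\mathrm{E}\,X_i(s)X_j(t)=\frac{\sigma_i\sigma_j}{2}\left\{d_{ij}\,(|s|+|t|-|s-t|)+f_{ij}\,\bigl(t\log|t|-s\log|s|-(t-s)\log|t-s|\bigr)\right\},$$ where $d_{ij}$ and $f_{ij}$ are given by $$\sigma_i\sigma_j\,d_{ij}=B(H_i+.5,\,H_j+.5)\left\{\frac{\sin(H_i\pi)+\sin(H_j\pi)}{2}\,(\alpha^{++}_{ij}+\alpha^{--}_{ij})-\alpha^{+-}_{ij}-\alpha^{-+}_{ij}\right\},$$ $$\sigma_i\sigma_j\,f_{ij}=(H_j-H_i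)(\alpha^{++}_{ij}-\alpha^{--}_{ij}).$$
   Context: Notation: $x_+:=\max(x,0)$, $x_-:=\max(-x,0)$; $H-.5:=\mathrm{diag}(H_1-.5,\dots,H_p-.5)$, and for a scalar $y$, $y_\pm^{H-.5}$ is the diagonal matrix $\mathrm{diag}(y_\pm^{H_1-.5},\dots,y_\pm^{H_p-.5})$, with the convention that $y_\pm^{H_i-.5}=0$ when $y_\pm=0$ (in particular for $H_i=.5$, $y_+^{0}=\mathbf{1}_{\{y>0\}}$ and $y_-^{0}=\mathbf{1}_{\{y<0\}}$). Thus, componentwise, $$X_i(t)=\sum_{k=1}^p\int_{\mathbb{R}}\left\{a^+_{ik}\left((t-x)_+^{H_i-.5}-(-x)_+^{H_i-.5}\right)+a^-_{ik}\left((t-x)_-^{H_i-.5}-(-x)_-^{H_i-.5}\right)\right\}W_k(\mathrm{d}x),$$ where the integrals are Wiener integrals. $B(\cdot,\cdot)$ is the Euler Beta function and $\delta_{ij}$ the Kronecker delta. Conventions: $0\log0=0$; terms $c(u)|u|^a$ with $a>0$ are $0$ when $u=0$, so the value of $c_{ij}(\cdot)$ at $0$ is irrelevant. The formulas giving $c_{ij}$, $d_{ij}$, $f_{ij}$ are to be read as fixing the products $\frac{\sigma_i\sigma_j}{2}c_{ij}$, $\sigma_i\sigma_jd_{ij}$, $\sigma_i\sigma_jf_{ij}$ appearing in the covariance formulas. *)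

theory Defs
  imports "HOL-Probability.Probability"
begin

section \<open>Gaussian white noise\<close>

text \<open>Constants are included as degenerate Gaussian variables.\<close>

definition gaussian_rv :: "'a measure \<Rightarrow> ('a \<Rightarrow> real) \<Rightarrow> bool" where
  "gaussian_rv M Y \<longleftrightarrow> Y \<in> borel_measurable M \<and>
     ((\<exists>m. AE \<omega> in M. Y \<omega> = m) \<or>
      (\<exists>m s. s > 0 \<and> distributed M lborel Y (\<lambda>y. ennreal (normal_density m s y))))"

definition finite_borel :: "real set set" where
  "finite_borel = {A \<in> sets borel. emeasure lborel A < \<infinity>}"

text \<open>
  A white noise is a random set function: \<open>W A \<omega> $ k\<close> is the mass given to \<open>A\<close> by the
  \<open>k\<close>-th component, and E \<open>W\<^sub>i(dx) W\<^sub>j(dx) = \<delta>\<^sub>i\<^sub>j dx\<close> means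
  E \<open>W\<^sub>i(A) W\<^sub>j(B) = \<delta>\<^sub>i\<^sub>j |A \<inter> B|\<close>. The third clause says that the family of all \<open>W\<^sub>k(A)\<close> is
  jointly Gaussian (every finite linear combination is Gaussian). Additivity of \<open>W\<close> in \<open>A\<close>
  (almost surely, and countably in mean square) is a consequence of the covariance.
\<close>

definition gaussian_white_noise ::
    "'a measure \<Rightarrow> (real set \<Rightarrow> 'a \<Rightarrow> real ^ 'p::finite) \<Rightarrow> bool" where
  "gaussian_white_noise M W \<longleftrightarrow>
     prob_space M \<and>
     (\<forall>A\<in>finite_borel. W A \<in> borel_measurable M) \<and>
     (\<forall>F (u :: real set \<Rightarrow> real ^ 'p). finite F \<and> F \<subseteq> finite_borel \<longrightarrow>
        gaussian_rv M (\<lambda>\<omega>. \<Sum>A\<in>F. u A \<bullet> W A \<omega>)) \<and>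
     (\<forall>A\<in>finite_borel. \<forall>i. prob_space.expectation M (\<lambda>\<omega>. W A \<omega> $ i) = 0) \<and>
     (\<forall>A\<in>finite_borel. \<forall>B\<in>finite_borel. \<forall>i j.
        prob_space.expectation M (\<lambda>\<omega>. W A \<omega> $ i * W B \<omega> $ j) =
          (if i = j then measure lborel (A \<inter> B) else 0)) \<and>
     prob_space.indep_vars M (\<lambda>_. PiM finite_borel (\<lambda>_. borel))
       (\<lambda>k \<omega>. \<lambda>A\<in>finite_borel. W A \<omega> $ k) (UNIV :: 'p set)"

section \<open>Wiener integral\<close>

text \<open>
  The list \<open>[(c\<^sub>1, A\<^sub>1), \<dots>, (c\<^sub>n, A\<^sub>n)]\<close> represents the step function
  \<open>c\<^sub>1 1\<^bsub>A\<^sub>1\<^esub> + \<dots> + c\<^sub>n 1\<^bsub>A\<^sub>n\<^esub>\<close>.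
\<close>

definition step_fun :: "(real \<times> real set) list \<Rightarrow> real \<Rightarrow> real" where
  "step_fun S x = (\<Sum>(c, A)\<leftarrow>S. c * indicator A x)"

definition step_int :: "(real set \<Rightarrow> 'a \<Rightarrow> real) \<Rightarrow> (real \<times> real set) list \<Rightarrow> 'a \<Rightarrow> real" where
  "step_int w S \<omega> = (\<Sum>(c, A)\<leftarrow>S. c * w A \<omega>)"

text \<open>
  \<open>Y\<close> is a version of the integral of \<open>g\<close>: the limit in mean square of the integrals of step
  functions converging to \<open>g\<close> in \<open>L\<^sup>2\<close> of the line (which forces \<open>g\<close> to be square integrable).
\<close>

definition has_wiener_integral ::
    "'a measure \<Rightarrow> (real set \<Rightarrow> 'a \<Rightarrow> real) \<Rightarrow> (real \<Rightarrow> real) \<Rightarrow> ('a \<Rightarrow> real) \<Rightarrow> bool" where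
  "has_wiener_integral M w g Y \<longleftrightarrow>
     g \<in> borel_measurable borel \<and> Y \<in> borel_measurable M \<and>
     (\<exists>S. (\<forall>n. snd ` set (S n) \<subseteq> finite_borel) \<and>
          (\<lambda>n. \<integral>\<^sup>+ x. ennreal ((g x - step_fun (S n) x)\<^sup>2) \<partial>lborel) \<longlonglongrightarrow> 0 \<and>
          (\<lambda>n. \<integral>\<^sup>+ \<omega>. ennreal ((Y \<omega> - step_int w (S n) \<omega>)\<^sup>2) \<partial>M) \<longlonglongrightarrow> 0)"

definition has_wiener_integral_matrix ::
    "'a measure \<Rightarrow> (real set \<Rightarrow> 'a \<Rightarrow> real ^ 'p::finite) \<Rightarrow> (real \<Rightarrow> real ^ 'p ^ 'p) \<Rightarrow>
     ('a \<Rightarrow> real ^ 'p) \<Rightarrow> bool" where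
  "has_wiener_integral_matrix M W Q Y \<longleftrightarrow>
     (\<exists>J. (\<forall>i k. has_wiener_integral M (\<lambda>A \<omega>. W A \<omega> $ k) (\<lambda>x. Q x $ i $ k) (J i k)) \<and>
          (\<forall>\<omega>\<in>space M. \<forall>i. Y \<omega> $ i = (\<Sum>k\<in>UNIV. J i k \<omega>)))"

section \<open>The process\<close>

definition pos_part :: "real \<Rightarrow> real" where
  "pos_part y = max y 0"

definition neg_part :: "real \<Rightarrow> real" where
  "neg_part y = max (- y) 0"

text \<open>
  For \<open>y \<ge> 0\<close> this is the matrix \<open>y\<^bsup>H - .5\<^esup>\<close>. As \<open>0 powr a = 0\<close> for every \<open>a\<close>, including \<open>a = 0\<close>,
  the convention for vanishing \<open>y\<close> is built in.
\<close>

definition diag_power :: "real \<Rightarrow> real ^ 'p \<Rightarrow> real ^ 'p ^ 'p" where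
  "diag_power y H = (\<chi> i j. if i = j then y powr (H $ i - 1 / 2) else 0)"

definition mfbm_kernel ::
    "real ^ 'p \<Rightarrow> real ^ 'p ^ 'p \<Rightarrow> real ^ 'p ^ 'p \<Rightarrow> real \<Rightarrow> real \<Rightarrow> real ^ 'p ^ 'p::finite" where
  "mfbm_kernel H Ap Am t x =
     (diag_power (pos_part (t - x)) H - diag_power (pos_part (- x)) H) ** Ap +
     (diag_power (neg_part (t - x)) H - diag_power (neg_part (- x)) H) ** Am"

section \<open>Ingredients of the covariance formulas\<close>

definition \<alpha> :: "real ^ 'p ^ 'p \<Rightarrow> real ^ 'p ^ 'p \<Rightarrow> 'p \<Rightarrow> 'p::finite \<Rightarrow> real" where
  "\<alpha> A B i j = (\<Sum>k\<in>UNIV. A $ i $ k * B $ j $ k)"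

text \<open>
  The function \<open>c\<^sub>i\<^sub>j(u)\<close>. Its value at \<open>0\<close> is irrelevant, being always multiplied by
  \<open>0 powr (H\<^sub>i + H\<^sub>j) = 0\<close>.
\<close>

definition sign_select :: "('p \<Rightarrow> 'p \<Rightarrow> real) \<Rightarrow> 'p \<Rightarrow> 'p \<Rightarrow> real \<Rightarrow> real" where
  "sign_select c i j u = (if u > 0 then c i j else c j i)"

end

theory Submission
  imports Defs "HOL-Real_Asymp.Real_Asymp"
begin

text \<open>
  The Wiener integral is an isometry, so the covariance of the coordinates \<open>i\<close> and \<open>j\<close> is a sum over
  the noise components of \<open>L\<^sup>2\<close> inner products of kernels (\<open>vector_wiener_integral_covariance\<close>).
  Each kernel entry is a combination of a forward and a backward scalar kernel, with exponents
  \<open>a = H\<^sub>i - 1/2\<close> and \<open>b = H\<^sub>j - 1/2\<close>, and everything reduces to the inner products of these scalar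
  kernels; throughout \<open>h = a + b + 1 = H\<^sub>i + H\<^sub>j\<close>.

  The product of a forward and a backward kernel splits into three Beta integrals and
  a vanishing piece; these give the \<open>\<alpha>\<^sup>+\<^sup>-\<close> and \<open>\<alpha>\<^sup>-\<^sup>+\<close> terms (\<open>has_bochner_integral_Beta_kernel\<close>).

  For two kernels of the same direction the four pieces
  \<open>(y + s)\<^sub>+\<^sup>a (y + t)\<^sub>+\<^sup>b\<close>, with \<open>s\<close> or \<open>t\<close> possibly replaced by \<open>0\<close>, diverge at infinity one by one, and
  only their alternating sum converges. Truncating at \<open>N\<close>, each piece behaves like
  \<open>\<rho>(N) + s \<rho>\<^sub>1(N) + t \<rho>\<^sub>2(N) + E(t - s)\<close> with \<open>E(t - s)\<close> independent of \<open>N\<close>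
  (\<open>trunc_inner_asymptotics\<close>). An affine function of \<open>(s, t)\<close> is annihilated
  by the alternating sum, hence the inner product is \<open>E(t - s) - E(-s) - E(t)\<close>
  (\<open>shift_diff_inner_product\<close>). The function \<open>E\<close> is called \<open>cov_profile\<close>.

  To find \<open>E\<close>, translation and scaling reduce a truncated piece to \<open>\<integral>\<^sub>0\<^sup>N y\<^sup>a (y + 1)\<^sup>b dy\<close>. Integration by
  parts lowers \<open>b\<close> by one at the cost of an explicit boundary term (\<open>trunc_Beta_recurrence\<close>). If
  \<open>h \<noteq> 1\<close>, two steps lead to a convergent Beta integral, and Euler's reflection formula turns the
  constant into \<open>B(a + 1, b + 1) sin(b \<pi>) / sin(h \<pi>)\<close>. If \<open>h = 1\<close>, the second step would divide by
  \<open>h - 1 = 0\<close>; after one step there remains a logarithm, which is the source of the terms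
  \<open>t log |t|\<close>, and a constant given by the Digamma function. Only the sum of the constants for
  \<open>(a, -a)\<close> and \<open>(-a, a)\<close> matters, and the reflection formula for Digamma evaluates it.

  The coefficients \<open>c\<close>, \<open>d\<close>, \<open>f\<close> are obtained by dividing by \<open>\<sigma>\<^sub>i \<sigma>\<^sub>j\<close>. If this product vanishes, so does
  the covariance at all times, by the Cauchy-Schwarz inequality; evaluating the covariance formula at
  a few times shows that the numerators vanish as well.
\<close>

section \<open>Inner products in mean square\<close>

lemma integrable_square_add:
  fixes f g :: "'a \<Rightarrow> real"
  assumes [measurable]: "f \<in> borel_measurable M" "g \<in> borel_measurable M"
    and "integrable M (\<lambda>x. (f x)\<^sup>2)" "integrable M (\<lambda>x. (g x)\<^sup>2)"
  shows "integrable M (\<lambda>x. (f x + g x)\<^sup>2)"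
proof (rule Bochner_Integration.integrable_bound)
  show "integrable M (\<lambda>x. 2 * (f x)\<^sup>2 + 2 * (g x)\<^sup>2)" using assms by simp
  show "AE x in M. norm ((f x + g x)\<^sup>2) \<le> norm (2 * (f x)\<^sup>2 + 2 * (g x)\<^sup>2)"
  proof (intro AE_I2)
    fix x
    have "0 \<le> (f x - g x)\<^sup>2" by simp
    then have "(f x + g x)\<^sup>2 \<le> 2 * (f x)\<^sup>2 + 2 * (g x)\<^sup>2"
      unfolding power2_sum power2_diff by linarith
    then show "norm ((f x + g x)\<^sup>2) \<le> norm (2 * (f x)\<^sup>2 + 2 * (g x)\<^sup>2)" by simp
  qed
qed measurable

lemma integrable_mult_of_square_integrable:
  fixes f g :: "'a \<Rightarrow> real"
  assumes [measurable]: "f \<in> borel_measurable M" "g \<in> borel_measurable M"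
    and "integrable M (\<lambda>x. (f x)\<^sup>2)" "integrable M (\<lambda>x. (g x)\<^sup>2)"
  shows "integrable M (\<lambda>x. f x * g x)"
proof -
  have "integrable M (\<lambda>x. ((f x + g x)\<^sup>2 - (f x)\<^sup>2 - (g x)\<^sup>2) / 2)"
    using assms integrable_square_add[of f M g] by auto
  then show ?thesis by (simp add: power2_sum)
qed

lemma Cauchy_Schwarz_integral:
  fixes f g :: "'a \<Rightarrow> real"
  assumes [measurable]: "f \<in> borel_measurable M" "g \<in> borel_measurable M"
    and f: "integrable M (\<lambda>x. (f x)\<^sup>2)" and g: "integrable M (\<lambda>x. (g x)\<^sup>2)"
  shows "\<bar>\<integral>x. f x * g x \<partial>M\<bar> \<le> sqrt (\<integral>x. (f x)\<^sup>2 \<partial>M) * sqrt (\<integral>x. (g x)\<^sup>2 \<partial>M)"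
proof -
  have fg: "integrable M (\<lambda>x. f x * g x)" by (rule integrable_mult_of_square_integrable) fact+
  have "(ennreal (\<integral>x. \<bar>f x * g x\<bar> \<partial>M))\<^sup>2 = (\<integral>\<^sup>+ x. ennreal \<bar>f x\<bar> * ennreal \<bar>g x\<bar> \<partial>M)\<^sup>2"
    using nn_integral_eq_integral[of M "\<lambda>x. \<bar>f x * g x\<bar>"] integrable_abs[OF fg]
    by (simp add: abs_mult ennreal_mult)
  also have "\<dots> \<le> (\<integral>\<^sup>+ x. (ennreal \<bar>f x\<bar>)\<^sup>2 \<partial>M) * (\<integral>\<^sup>+ x. (ennreal \<bar>g x\<bar>)\<^sup>2 \<partial>M)"
    by (rule Cauchy_Schwarz_nn_integral) measurable
  also have "\<dots> = ennreal ((\<integral>x. (f x)\<^sup>2 \<partial>M) * (\<integral>x. (g x)\<^sup>2 \<partial>M))"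
    using nn_integral_eq_integral[OF f] nn_integral_eq_integral[OF g] by (simp add: ennreal_power ennreal_mult)
  finally have "(\<integral>x. \<bar>f x * g x\<bar> \<partial>M)\<^sup>2 \<le> (\<integral>x. (f x)\<^sup>2 \<partial>M) * (\<integral>x. (g x)\<^sup>2 \<partial>M)"
    by (simp add: ennreal_power)
  then have "(\<integral>x. \<bar>f x * g x\<bar> \<partial>M) \<le> sqrt (\<integral>x. (f x)\<^sup>2 \<partial>M) * sqrt (\<integral>x. (g x)\<^sup>2 \<partial>M)"
    by (simp add: real_le_rsqrt flip: real_sqrt_mult)
  then show ?thesis using integral_abs_bound[of M "\<lambda>x. f x * g x"] by linarith
qed

text \<open>
  The hypothesis only makes the distance finite for large \<open>n\<close>. One such \<open>n\<close> puts \<open>f\<close> into \<open>L\<^sup>2\<close>, and then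
  the distance is finite for every \<open>n\<close>, so that it can be read as a Bochner integral.
\<close>

lemma L2_limit_square_integrable:
  fixes f :: "'a \<Rightarrow> real" and F :: "nat \<Rightarrow> 'a \<Rightarrow> real"
  assumes [measurable]: "f \<in> borel_measurable M" "\<And>n. F n \<in> borel_measurable M"
    and F: "\<And>n. integrable M (\<lambda>x. (F n x)\<^sup>2)"
    and lim: "(\<lambda>n. \<integral>\<^sup>+ x. ennreal ((f x - F n x)\<^sup>2) \<partial>M) \<longlonglongrightarrow> 0"
  shows "integrable M (\<lambda>x. (f x)\<^sup>2)"
    and "integrable M (\<lambda>x. (f x - F n x)\<^sup>2)"
    and "(\<lambda>n. \<integral>x. (f x - F n x)\<^sup>2 \<partial>M) \<longlonglongrightarrow> 0"
proof -
  have "\<forall>\<^sub>F n in sequentially. (\<integral>\<^sup>+ x. ennreal ((f x - F n x)\<^sup>2) \<partial>M) < 1"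
    using lim by (rule order_tendstoD) simp
  then obtain m where "(\<integral>\<^sup>+ x. ennreal ((f x - F m x)\<^sup>2) \<partial>M) < 1"
    by (auto simp: eventually_sequentially)
  then have "(\<integral>\<^sup>+ x. ennreal ((f x - F m x)\<^sup>2) \<partial>M) < \<infinity>" using less_trans by fastforce
  then have "integrable M (\<lambda>x. (f x - F m x)\<^sup>2)" by (intro integrableI_nonneg) auto
  from integrable_square_add[OF _ _ this F[of m]] show f: "integrable M (\<lambda>x. (f x)\<^sup>2)" by simp
  show i: "integrable M (\<lambda>x. (f x - F n x)\<^sup>2)" for n
    using integrable_square_add[OF _ _ f, of "\<lambda>x. - F n x"] F[of n] by simp
  show "(\<lambda>n. \<integral>x. (f x - F n x)\<^sup>2 \<partial>M) \<longlonglongrightarrow> 0"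
    using lim nn_integral_eq_integral[OF i] by (simp add: ennreal_tendsto_0_iff)
qed

text \<open>
  The inner product is jointly continuous: with \<open>u = f - F\<^sub>n\<close> and \<open>v = g - G\<^sub>n\<close> one has
  \<open>F\<^sub>n G\<^sub>n = u v - u g - f v + f g\<close>, and the first three terms vanish in the limit by Cauchy-Schwarz.
\<close>

lemma L2_limit_inner_product:
  fixes f g :: "'a \<Rightarrow> real" and F G :: "nat \<Rightarrow> 'a \<Rightarrow> real"
  assumes [measurable]: "f \<in> borel_measurable M" "g \<in> borel_measurable M"
      "\<And>n. F n \<in> borel_measurable M" "\<And>n. G n \<in> borel_measurable M"
    and F: "\<And>n. integrable M (\<lambda>x. (F n x)\<^sup>2)" and G: "\<And>n. integrable M (\<lambda>x. (G n x)\<^sup>2)"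
    and f: "(\<lambda>n. \<integral>\<^sup>+ x. ennreal ((f x - F n x)\<^sup>2) \<partial>M) \<longlonglongrightarrow> 0"
    and g: "(\<lambda>n. \<integral>\<^sup>+ x. ennreal ((g x - G n x)\<^sup>2) \<partial>M) \<longlonglongrightarrow> 0"
  shows "(\<lambda>n. \<integral>x. F n x * G n x \<partial>M) \<longlonglongrightarrow> (\<integral>x. f x * g x \<partial>M)"
proof -
  note fl = L2_limit_square_integrable[OF _ _ F f, simplified]
  note gl = L2_limit_square_integrable[OF _ _ G g, simplified]
  have zero: "(\<lambda>n. \<integral>x. u n x * v n x \<partial>M) \<longlonglongrightarrow> 0"
    if [measurable]: "\<And>n. u n \<in> borel_measurable M" "\<And>n. v n \<in> borel_measurable M"
      and uv: "\<And>n. integrable M (\<lambda>x. (u n x)\<^sup>2)" "\<And>n. integrable M (\<lambda>x. (v n x)\<^sup>2)"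
      and l: "(\<lambda>n. \<integral>x. (u n x)\<^sup>2 \<partial>M) \<longlonglongrightarrow> p" "(\<lambda>n. \<integral>x. (v n x)\<^sup>2 \<partial>M) \<longlonglongrightarrow> q" "p * q = 0"
    for u v :: "nat \<Rightarrow> 'a \<Rightarrow> real" and p q
  proof (rule Lim_null_comparison)
    have "(\<lambda>n. sqrt (\<integral>x. (u n x)\<^sup>2 \<partial>M) * sqrt (\<integral>x. (v n x)\<^sup>2 \<partial>M)) \<longlonglongrightarrow> sqrt p * sqrt q"
      by (intro tendsto_intros l)
    then show "(\<lambda>n. sqrt (\<integral>x. (u n x)\<^sup>2 \<partial>M) * sqrt (\<integral>x. (v n x)\<^sup>2 \<partial>M)) \<longlonglongrightarrow> 0"
      using l(3) by auto
    show "\<forall>\<^sub>F n in sequentially. norm (\<integral>x. u n x * v n x \<partial>M) \<le> sqrt (\<integral>x. (u n x)\<^sup>2 \<partial>M) * sqrt (\<integral>x. (v n x)\<^sup>2 \<partial>M)"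
      unfolding real_norm_def by (intro always_eventually allI Cauchy_Schwarz_integral uv) measurable
  qed
  let ?u = "\<lambda>n x. f x - F n x" and ?v = "\<lambda>n x. g x - G n x"
  note i = integrable_mult_of_square_integrable
  have eq: "(\<integral>x. F n x * G n x \<partial>M) = (\<integral>x. ?u n x * ?v n x \<partial>M) - (\<integral>x. ?u n x * g x \<partial>M) - (\<integral>x. f x * ?v n x \<partial>M) + (\<integral>x. f x * g x \<partial>M)" for n
  proof -
    have "integrable M (\<lambda>x. ?u n x * ?v n x)" "integrable M (\<lambda>x. ?u n x * g x)" "integrable M (\<lambda>x. f x * ?v n x)" "integrable M (\<lambda>x. f x * g x)"
      by (intro i fl(1,2) gl(1,2); measurable)+
    then have "(\<integral>x. ?u n x * ?v n x \<partial>M) - (\<integral>x. ?u n x * g x \<partial>M) - (\<integral>x. f x * ?v n x \<partial>M) + (\<integral>x. f x * g x \<partial>M) =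
      (\<integral>x. ?u n x * ?v n x - ?u n x * g x - f x * ?v n x + f x * g x \<partial>M)" by simp
    also have "\<dots> = (\<integral>x. F n x * G n x \<partial>M)"
      by (intro Bochner_Integration.integral_cong refl) (simp add: algebra_simps)
    finally show ?thesis by simp
  qed
  have "(\<lambda>n. (\<integral>x. ?u n x * ?v n x \<partial>M) - (\<integral>x. ?u n x * g x \<partial>M) - (\<integral>x. f x * ?v n x \<partial>M) + (\<integral>x. f x * g x \<partial>M)) \<longlonglongrightarrow> 0 - 0 - 0 + (\<integral>x. f x * g x \<partial>M)"
  proof (intro tendsto_intros)
    show "(\<lambda>n. \<integral>x. ?u n x * ?v n x \<partial>M) \<longlonglongrightarrow> 0"
      by (rule zero[OF _ _ _ _ fl(3) gl(3)]) (simp_all add: fl(2) gl(2))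
    show "(\<lambda>n. \<integral>x. ?u n x * g x \<partial>M) \<longlonglongrightarrow> 0"
      by (rule zero[OF _ _ _ _ fl(3) tendsto_const]) (simp_all add: fl(2) gl(1))
    show "(\<lambda>n. \<integral>x. f x * ?v n x \<partial>M) \<longlonglongrightarrow> 0"
      by (rule zero[OF _ _ _ _ tendsto_const gl(3)]) (simp_all add: fl(1) gl(2))
  qed
  then show ?thesis unfolding eq by simp
qed

section \<open>The isometry of the Wiener integral\<close>

lemma step_fun_Nil [simp]: "step_fun [] = (\<lambda>x. 0)" by (simp add: step_fun_def fun_eq_iff)
lemma step_fun_Cons [simp]: "step_fun (p # S) = (\<lambda>x. fst p * indicator (snd p) x + step_fun S x)"
  by (simp add: step_fun_def fun_eq_iff split_beta)
lemma step_int_Nil [simp]: "step_int w [] = (\<lambda>x. 0)" by (simp add: step_int_def fun_eq_iff)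
lemma step_int_Cons [simp]: "step_int w (p # S) = (\<lambda>x. fst p * w (snd p) x + step_int w S x)"
  by (simp add: step_int_def fun_eq_iff split_beta)

text \<open>
  What second-moment computations use about a single component of the noise; covariances, between
  equal or distinct components, enter the lemmas below as a separate hypothesis.
\<close>

definition centered_L2_set_function :: "'a measure \<Rightarrow> (real set \<Rightarrow> 'a \<Rightarrow> real) \<Rightarrow> bool" where
  "centered_L2_set_function M w \<longleftrightarrow>
    (\<forall>A\<in>finite_borel. w A \<in> borel_measurable M \<and> integrable M (\<lambda>\<omega>. (w A \<omega>)\<^sup>2) \<and> (\<integral>\<omega>. w A \<omega> \<partial>M) = 0)"

lemma step_fun_square_integrable:
  assumes "snd ` set S \<subseteq> finite_borel"
  shows "step_fun S \<in> borel_measurable borel" "integrable lborel (\<lambda>x. (step_fun S x)\<^sup>2)"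
proof (atomize (full), use assms in \<open>induction S\<close>)
  case (Cons p S)
  have p: "snd p \<in> sets borel" "emeasure lborel (snd p) < \<infinity>" using Cons.prems by (auto simp: finite_borel_def)
  have "(\<lambda>x. (fst p * indicator (snd p) x)\<^sup>2) = (\<lambda>x. (fst p)\<^sup>2 * indicator (snd p) x)"
    by (auto simp: indicator_def)
  then have "integrable lborel (\<lambda>x. (fst p * indicator (snd p) x)\<^sup>2)"
    using p by simp
  with Cons p show ?case
    by (auto intro!: integrable_square_add)
qed simp

lemma step_int_square_integrable:
  assumes "centered_L2_set_function M w" "snd ` set S \<subseteq> finite_borel"
  shows "step_int w S \<in> borel_measurable M" "integrable M (\<lambda>x. (step_int w S x)\<^sup>2)"
proof (atomize (full), use assms in \<open>induction S\<close>)
  case (Cons p S)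
  then have p: "w (snd p) \<in> borel_measurable M" "integrable M (\<lambda>x. (w (snd p) x)\<^sup>2)"
    by (auto simp: centered_L2_set_function_def)
  with Cons show ?case
    by (auto intro!: integrable_square_add simp: power_mult_distrib)
qed simp

text \<open>
  Both sides are bilinear in the two lists, so that the covariance of the noise on pairs of sets
  determines them. The factor \<open>\<delta>\<close> covers equal (\<open>1\<close>) and distinct (\<open>0\<close>) noise components at once.
\<close>

lemma step_int_inner_product:
  assumes w: "centered_L2_set_function M w" and w': "centered_L2_set_function M w'"
    and cov: "\<And>A B. A \<in> finite_borel \<Longrightarrow> B \<in> finite_borel \<Longrightarrow> (\<integral>\<omega>. w A \<omega> * w' B \<omega> \<partial>M) = \<delta> * measure lborel (A \<inter> B)"
    and S: "snd ` set S \<subseteq> finite_borel" and S': "snd ` set S' \<subseteq> finite_borel"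
  shows "(\<integral>\<omega>. step_int w S \<omega> * step_int w' S' \<omega> \<partial>M) = \<delta> * (\<integral>x. step_fun S x * step_fun S' x \<partial>lborel)"
proof -
  note i = integrable_mult_of_square_integrable
  have w_int: "w A \<in> borel_measurable M" "integrable M (\<lambda>\<omega>. (w A \<omega>)\<^sup>2)"
     "w' A \<in> borel_measurable M" "integrable M (\<lambda>\<omega>. (w' A \<omega>)\<^sup>2)" if "A \<in> finite_borel" for A
    using w w' that by (auto simp: centered_L2_set_function_def)
  have ind: "(indicator A :: real \<Rightarrow> real) \<in> borel_measurable lborel" "integrable lborel (\<lambda>x. (indicator A x :: real)\<^sup>2)" if "A \<in> finite_borel" for A
    using step_fun_square_integrable[of "[(1, A)]"] that by simp_all
  have 1: "(\<integral>\<omega>. w A \<omega> * step_int w' S' \<omega> \<partial>M) = \<delta> * (\<integral>x. indicator A x * step_fun S' x \<partial>lborel)"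
    if A: "A \<in> finite_borel" for A
    using S'
  proof (induction S')
    case (Cons p S')
    then have p: "snd p \<in> finite_borel" and S': "snd ` set S' \<subseteq> finite_borel" by auto
    have "integrable M (\<lambda>\<omega>. w A \<omega> * w' (snd p) \<omega>)" "integrable M (\<lambda>\<omega>. w A \<omega> * step_int w' S' \<omega>)"
      by (intro i w_int A p step_int_square_integrable[OF w' S'])+
    then have "(\<integral>\<omega>. fst p * (w A \<omega> * w' (snd p) \<omega>) + w A \<omega> * step_int w' S' \<omega> \<partial>M) =
        fst p * (\<delta> * measure lborel (A \<inter> snd p)) + \<delta> * (\<integral>x. indicator A x * step_fun S' x \<partial>lborel)"
      using Cons.IH[OF S'] cov[OF A p] by simp
    moreover have "integrable lborel (\<lambda>x. indicator A x * indicator (snd p) x :: real)" "integrable lborel (\<lambda>x. indicator A x * step_fun S' x)"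
      using step_fun_square_integrable[OF S'] by (intro i ind A p; simp)+
    then have "(\<integral>x. fst p * (indicator A x * indicator (snd p) x) + indicator A x * step_fun S' x \<partial>lborel) =
        fst p * measure lborel (A \<inter> snd p) + (\<integral>x. indicator A x * step_fun S' x \<partial>lborel)"
      by (simp flip: indicator_inter_arith)
    ultimately show ?case by (simp add: algebra_simps)
  qed simp
  show ?thesis
    using S
  proof (induction S)
    case (Cons p S)
    then have p: "snd p \<in> finite_borel" and S: "snd ` set S \<subseteq> finite_borel" by auto
    have "integrable M (\<lambda>\<omega>. w (snd p) \<omega> * step_int w' S' \<omega>)" "integrable M (\<lambda>\<omega>. step_int w S \<omega> * step_int w' S' \<omega>)"
      by (intro i w_int p step_int_square_integrable[OF w S] step_int_square_integrable[OF w' S'])+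
    then have "(\<integral>\<omega>. fst p * (w (snd p) \<omega> * step_int w' S' \<omega>) + step_int w S \<omega> * step_int w' S' \<omega> \<partial>M) =
        fst p * (\<delta> * (\<integral>x. indicator (snd p) x * step_fun S' x \<partial>lborel)) + \<delta> * (\<integral>x. step_fun S x * step_fun S' x \<partial>lborel)"
      using Cons.IH[OF S] 1[OF p] by simp
    moreover have "integrable lborel (\<lambda>x. indicator (snd p) x * step_fun S' x)" "integrable lborel (\<lambda>x. step_fun S x * step_fun S' x)"
      using step_fun_square_integrable[OF S] step_fun_square_integrable[OF S'] by (intro i ind p; simp)+
    then have "(\<integral>x. fst p * (indicator (snd p) x * step_fun S' x) + step_fun S x * step_fun S' x \<partial>lborel) =
        fst p * (\<integral>x. indicator (snd p) x * step_fun S' x \<partial>lborel) + (\<integral>x. step_fun S x * step_fun S' x \<partial>lborel)"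
      by simp
    ultimately show ?case by (simp add: algebra_simps)
  qed simp
qed

text \<open>
  The identity for step functions passes to the limit on both sides, on the probability space and on
  the line. In particular the value does not depend on the approximating sequence.
\<close>

lemma wiener_integral_isometry:
  assumes w: "centered_L2_set_function M w" and w': "centered_L2_set_function M w'"
    and cov: "\<And>A B. A \<in> finite_borel \<Longrightarrow> B \<in> finite_borel \<Longrightarrow> (\<integral>\<omega>. w A \<omega> * w' B \<omega> \<partial>M) = \<delta> * measure lborel (A \<inter> B)"
    and Y: "has_wiener_integral M w g Y" and Y': "has_wiener_integral M w' g' Y'"
  shows "(\<integral>\<omega>. Y \<omega> * Y' \<omega> \<partial>M) = \<delta> * (\<integral>x. g x * g' x \<partial>lborel)"
proof -
  from Y obtain S where m: "g \<in> borel_measurable borel" "Y \<in> borel_measurable M" and S: "\<And>n. snd ` set (S n) \<subseteq> finite_borel"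
    and gl: "(\<lambda>n. \<integral>\<^sup>+ x. ennreal ((g x - step_fun (S n) x)\<^sup>2) \<partial>lborel) \<longlonglongrightarrow> 0"
    and Yl: "(\<lambda>n. \<integral>\<^sup>+ \<omega>. ennreal ((Y \<omega> - step_int w (S n) \<omega>)\<^sup>2) \<partial>M) \<longlonglongrightarrow> 0"
    unfolding has_wiener_integral_def by blast
  from Y' obtain S' where m': "g' \<in> borel_measurable borel" "Y' \<in> borel_measurable M" and S': "\<And>n. snd ` set (S' n) \<subseteq> finite_borel"
    and gl': "(\<lambda>n. \<integral>\<^sup>+ x. ennreal ((g' x - step_fun (S' n) x)\<^sup>2) \<partial>lborel) \<longlonglongrightarrow> 0"
    and Yl': "(\<lambda>n. \<integral>\<^sup>+ \<omega>. ennreal ((Y' \<omega> - step_int w' (S' n) \<omega>)\<^sup>2) \<partial>M) \<longlonglongrightarrow> 0"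
    unfolding has_wiener_integral_def by blast
  have "(\<lambda>n. \<integral>\<omega>. step_int w (S n) \<omega> * step_int w' (S' n) \<omega> \<partial>M) \<longlonglongrightarrow> (\<integral>\<omega>. Y \<omega> * Y' \<omega> \<partial>M)"
    by (rule L2_limit_inner_product) (use m m' Yl Yl' step_int_square_integrable[OF w S] step_int_square_integrable[OF w' S'] in auto)
  moreover have "(\<lambda>n. \<integral>x. step_fun (S n) x * step_fun (S' n) x \<partial>lborel) \<longlonglongrightarrow> (\<integral>x. g x * g' x \<partial>lborel)"
    by (rule L2_limit_inner_product) (use m m' gl gl' step_fun_square_integrable[OF S] step_fun_square_integrable[OF S'] in auto)
  then have "(\<lambda>n. \<delta> * (\<integral>x. step_fun (S n) x * step_fun (S' n) x \<partial>lborel)) \<longlonglongrightarrow> \<delta> * (\<integral>x. g x * g' x \<partial>lborel)"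
    by (rule tendsto_mult_left)
  moreover have "(\<integral>\<omega>. step_int w (S n) \<omega> * step_int w' (S' n) \<omega> \<partial>M) = \<delta> * (\<integral>x. step_fun (S n) x * step_fun (S' n) x \<partial>lborel)" for n
    by (rule step_int_inner_product[OF w w' _ S S']) (rule cov)
  ultimately show ?thesis by (simp add: LIMSEQ_unique)
qed

text \<open>
  The mean is the inner product with the constant \<open>1\<close>, and is therefore a limit of means of step
  integrals.
\<close>

lemma wiener_integral_moments:
  assumes "prob_space M" and w: "centered_L2_set_function M w" and Y: "has_wiener_integral M w g Y"
  shows "Y \<in> borel_measurable M" "integrable M (\<lambda>\<omega>. (Y \<omega>)\<^sup>2)" "(\<integral>\<omega>. Y \<omega> \<partial>M) = 0"
proof -
  interpret prob_space M by fact
  from Y obtain S where m: "Y \<in> borel_measurable M" and S: "\<And>n. snd ` set (S n) \<subseteq> finite_borel"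
    and Yl: "(\<lambda>n. \<integral>\<^sup>+ \<omega>. ennreal ((Y \<omega> - step_int w (S n) \<omega>)\<^sup>2) \<partial>M) \<longlonglongrightarrow> 0"
    unfolding has_wiener_integral_def by blast
  show "Y \<in> borel_measurable M" by fact
  note st = step_int_square_integrable[OF w S]
  show "integrable M (\<lambda>\<omega>. (Y \<omega>)\<^sup>2)" by (rule L2_limit_square_integrable(1)[OF m st Yl])
  have mean: "(\<integral>\<omega>. step_int w S \<omega> \<partial>M) = 0" if "snd ` set S \<subseteq> finite_borel" for S
    using that
  proof (induction S)
    case (Cons p S)
    then have p: "snd p \<in> finite_borel" and S: "snd ` set S \<subseteq> finite_borel" by auto
    have "integrable M (w (snd p))" "integrable M (step_int w S)" "(\<integral>\<omega>. w (snd p) \<omega> \<partial>M) = 0"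
      using w p step_int_square_integrable[OF w S] unfolding centered_L2_set_function_def
      by (auto intro: square_integrable_imp_integrable)
    then show ?case using Cons.IH[OF S] by simp
  qed simp
  have "(\<lambda>n. \<integral>\<omega>. step_int w (S n) \<omega> * 1 \<partial>M) \<longlonglongrightarrow> (\<integral>\<omega>. Y \<omega> * 1 \<partial>M)"
    by (rule L2_limit_inner_product) (use m Yl st in auto)
  then show "(\<integral>\<omega>. Y \<omega> \<partial>M) = 0" unfolding mult_1_right mean[OF S] by (simp add: LIMSEQ_const_iff)
qed

text \<open>
  A Bochner integral can take the prescribed value \<open>0\<close> without the integrand being integrable, so the
  covariance axiom alone does not place the noise in \<open>L\<^sup>2\<close>; Gaussianity does.
\<close>

lemma gaussian_rv_square_integrable:
  assumes "prob_space M" "gaussian_rv M Y"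
  shows "integrable M (\<lambda>\<omega>. (Y \<omega>)\<^sup>2)"
proof -
  interpret prob_space M by fact
  have [measurable]: "Y \<in> borel_measurable M" using assms by (simp add: gaussian_rv_def)
  from assms(2) consider m where "AE \<omega> in M. Y \<omega> = m"
    | m s where "s > 0" "distributed M lborel Y (\<lambda>y. ennreal (normal_density m s y))"
    by (auto simp: gaussian_rv_def)
  then show ?thesis
  proof cases
    case 1
    then have "AE \<omega> in M. (Y \<omega>)\<^sup>2 = m\<^sup>2" by eventually_elim simp
    then have "integrable M (\<lambda>\<omega>. (Y \<omega>)\<^sup>2) \<longleftrightarrow> integrable M (\<lambda>\<omega>. m\<^sup>2)"
      by (intro integrable_cong_AE) auto
    then show ?thesis by simp
  next
    case 2
    have "integrable lborel (\<lambda>y. normal_density m s y * (y - m)^2)"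
      "integrable lborel (\<lambda>y. normal_density m s y * y)" "integrable lborel (normal_density m s)"
      using 2 integrable_normal_moment integrable_normal_moment_nz_1 by auto
    then have "integrable lborel (\<lambda>y. normal_density m s y * (y - m)^2 + 2 * m * (normal_density m s y * y) - m\<^sup>2 * normal_density m s y)"
      by (intro Bochner_Integration.integrable_add Bochner_Integration.integrable_diff integrable_mult_right)
    then have "integrable lborel (\<lambda>y. normal_density m s y * y\<^sup>2)"
      by (simp add: power2_eq_square algebra_simps)
    then show ?thesis
      using distributed_integrable[OF 2(2), of "\<lambda>y. y\<^sup>2"] by simp
  qed
qed

lemma white_noise_coordinate:
  assumes W: "gaussian_white_noise M W"
  shows "centered_L2_set_function M (\<lambda>A \<omega>. W A \<omega> $ k)"
proof -
  have "prob_space M" using W by (simp add: gaussian_white_noise_def)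
  moreover have "gaussian_rv M (\<lambda>\<omega>. W A \<omega> $ k)" if "A \<in> finite_borel" for A
  proof -
    have "\<forall>F (u :: real set \<Rightarrow> real ^ 'b). finite F \<and> F \<subseteq> finite_borel \<longrightarrow> gaussian_rv M (\<lambda>\<omega>. \<Sum>A\<in>F. u A \<bullet> W A \<omega>)"
      using W by (simp add: gaussian_white_noise_def)
    \<comment> \<open>Joint Gaussianity for a single set and a unit vector.\<close>
    from this[rule_format, of "{A}" "\<lambda>_. axis k 1"] show ?thesis using that by (simp add: inner_axis')
  qed
  moreover have "(\<integral>\<omega>. W A \<omega> $ k \<partial>M) = 0" if "A \<in> finite_borel" for A
    using W that by (simp add: gaussian_white_noise_def)
  ultimately show ?thesis
    by (auto simp: centered_L2_set_function_def gaussian_rv_square_integrable) (simp add: gaussian_rv_def)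
qed

text \<open>
  Distinct noise components are orthogonal, so only the diagonal of the double sum over components
  survives.
\<close>

lemma vector_wiener_integral_covariance:
  fixes W :: "real set \<Rightarrow> 'a \<Rightarrow> real ^ 'p::finite"
  assumes W: "gaussian_white_noise M W"
    and Y: "has_wiener_integral_matrix M W Q Y" and Y': "has_wiener_integral_matrix M W Q' Y'"
  shows "(\<integral>\<omega>. Y \<omega> $ i * Y' \<omega> $ j \<partial>M) = (\<Sum>k\<in>UNIV. \<integral>x. Q x $ i $ k * Q' x $ j $ k \<partial>lborel)"
    and "(\<integral>\<omega>. Y \<omega> $ i \<partial>M) = 0"
    and "(\<lambda>\<omega>. Y \<omega> $ i) \<in> borel_measurable M"
    and "integrable M (\<lambda>\<omega>. (Y \<omega> $ i)\<^sup>2)"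
proof -
  have P: "prob_space M" using W by (simp add: gaussian_white_noise_def)
  then interpret prob_space M .
  note w = white_noise_coordinate[OF W]
  have cov: "(\<integral>\<omega>. W A \<omega> $ k * W B \<omega> $ l \<partial>M) = (if k = l then 1 else 0) * measure lborel (A \<inter> B)"
    if "A \<in> finite_borel" "B \<in> finite_borel" for A B k l
    using W that by (simp add: gaussian_white_noise_def)
  from Y obtain J where J: "\<And>i k. has_wiener_integral M (\<lambda>A \<omega>. W A \<omega> $ k) (\<lambda>x. Q x $ i $ k) (J i k)"
    and YJ: "\<And>\<omega> i. \<omega> \<in> space M \<Longrightarrow> Y \<omega> $ i = (\<Sum>k\<in>UNIV. J i k \<omega>)"
    unfolding has_wiener_integral_matrix_def by blast
  from Y' obtain J' where J': "\<And>i k. has_wiener_integral M (\<lambda>A \<omega>. W A \<omega> $ k) (\<lambda>x. Q' x $ i $ k) (J' i k)"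
    and YJ': "\<And>\<omega> i. \<omega> \<in> space M \<Longrightarrow> Y' \<omega> $ i = (\<Sum>k\<in>UNIV. J' i k \<omega>)"
    unfolding has_wiener_integral_matrix_def by blast
  note m = wiener_integral_moments[OF P w J] and m' = wiener_integral_moments[OF P w J']
  have "(\<integral>\<omega>. Y \<omega> $ i * Y' \<omega> $ j \<partial>M) = (\<integral>\<omega>. (\<Sum>k\<in>UNIV. \<Sum>l\<in>UNIV. J i k \<omega> * J' j l \<omega>) \<partial>M)"
    by (intro Bochner_Integration.integral_cong refl) (simp add: YJ YJ' sum_product)
  also have "\<dots> = (\<Sum>k\<in>UNIV. \<Sum>l\<in>UNIV. \<integral>\<omega>. J i k \<omega> * J' j l \<omega> \<partial>M)"
    by (simp add: integrable_mult_of_square_integrable m m')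
  also have "\<dots> = (\<Sum>k\<in>UNIV. \<Sum>l\<in>UNIV. (if k = l then 1 else 0) * (\<integral>x. Q x $ i $ k * Q' x $ j $ l \<partial>lborel))"
    by (intro sum.cong refl wiener_integral_isometry[OF w w cov J J'])
  also have "\<dots> = (\<Sum>k\<in>UNIV. \<integral>x. Q x $ i $ k * Q' x $ j $ k \<partial>lborel)"
    by (simp add: if_distrib[of "\<lambda>x. x * _"] cong: if_cong)
  finally show "(\<integral>\<omega>. Y \<omega> $ i * Y' \<omega> $ j \<partial>M) = (\<Sum>k\<in>UNIV. \<integral>x. Q x $ i $ k * Q' x $ j $ k \<partial>lborel)" .
  have "(\<integral>\<omega>. Y \<omega> $ i \<partial>M) = (\<integral>\<omega>. (\<Sum>k\<in>UNIV. J i k \<omega>) \<partial>M)"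
    by (intro Bochner_Integration.integral_cong refl YJ)
  also have "\<dots> = 0" using m by (simp add: square_integrable_imp_integrable)
  finally show "(\<integral>\<omega>. Y \<omega> $ i \<partial>M) = 0" .
  have "(\<lambda>\<omega>. \<Sum>k\<in>UNIV. J i k \<omega>) \<in> borel_measurable M" using m by simp
  then show "(\<lambda>\<omega>. Y \<omega> $ i) \<in> borel_measurable M"
    by (subst measurable_cong[where g = "\<lambda>\<omega>. \<Sum>k\<in>UNIV. J i k \<omega>"]) (simp_all add: YJ)
  have "integrable M (\<lambda>\<omega>. \<Sum>k\<in>UNIV. \<Sum>l\<in>UNIV. J i k \<omega> * J i l \<omega>)"
    by (simp add: integrable_mult_of_square_integrable m)
  then show "integrable M (\<lambda>\<omega>. (Y \<omega> $ i)\<^sup>2)"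
    by (subst Bochner_Integration.integrable_cong[OF refl, where g = "\<lambda>\<omega>. \<Sum>k\<in>UNIV. \<Sum>l\<in>UNIV. J i k \<omega> * J i l \<omega>"])
      (simp_all add: YJ power2_eq_square sum_product)
qed

section \<open>Gamma, Beta and Digamma\<close>

lemma nonneg_has_integral_imp_set_integral:
  fixes f :: "real \<Rightarrow> real"
  assumes [measurable]: "f \<in> borel_measurable borel" "S \<in> sets borel"
    and nonneg: "\<And>x. x \<in> S \<Longrightarrow> 0 \<le> f x" and I: "(f has_integral I) S"
  shows "set_integrable lborel S f" "(LBINT x:S. f x) = I"
proof -
  have "0 \<le> I" using has_integral_nonneg[OF I nonneg] by simp
  moreover have "(\<integral>\<^sup>+ x. ennreal (indicator S x * f x) \<partial>lborel) = ennreal I"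
    using nn_integral_has_integral_lebesgue[OF nonneg I] by simp
  ultimately have "has_bochner_integral lborel (\<lambda>x. indicator S x * f x) I"
    using nonneg by (intro has_bochner_integral_nn_integral) (auto simp: indicator_def)
  then show "set_integrable lborel S f" "(LBINT x:S. f x) = I"
    by (auto simp: has_bochner_integral_iff set_integrable_def set_lebesgue_integral_def)
qed

lemma set_integral_powr_unit:
  fixes c :: real assumes "c > -1"
  shows "set_integrable lborel {0..1} (\<lambda>z. z powr c)" "(LBINT z:{0..1}. z powr c) = 1 / (c + 1)"
  using nonneg_has_integral_imp_set_integral[of "\<lambda>z. z powr c" "{0..1}" "1 / (c + 1)"]
    has_integral_powr_from_0[OF assms, of 1] by auto

text \<open>
  Expanding \<open>1 / (1 - z)\<close> geometrically gives the series \<open>\<Sum> 1/(n + 1) - 1/(n + 1 + a)\<close> of the Digamma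
  function. All terms of the expansion have the same sign, which justifies termwise integration.
\<close>

lemma Digamma_integral:
  fixes a :: real assumes a: "a > -1"
  shows "set_integrable lborel {0..1} (\<lambda>z. (1 - z powr a) / (1 - z))"
    and "(LBINT z:{0..1}. (1 - z powr a) / (1 - z)) = Digamma (a + 1) + euler_mascheroni"
proof -
  define f where "f n z = indicator {0..1} z * (z powr real n - z powr (real n + a))" for n and z :: real
  have int: "integrable lborel (f n)" and val: "integral\<^sup>L lborel (f n) = inverse (real (Suc n)) - inverse (a + 1 + real n)" for n
  proof -
    note i = set_integral_powr_unit[of "real n"] set_integral_powr_unit[of "real n + a"]
    have f: "f n = (\<lambda>z. indicator {0..1} z *\<^sub>R (z powr real n - z powr (real n + a)))"
      by (rule ext) (simp add: f_def)
    have c: "real n > -1" "real n + a > -1" using a by auto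
    note d = set_integral_diff[OF set_integral_powr_unit(1)[OF c(1)] set_integral_powr_unit(1)[OF c(2)]]
    show "integrable lborel (f n)"
      unfolding f using d(1) by (simp only: set_integrable_def)
    show "integral\<^sup>L lborel (f n) = inverse (real (Suc n)) - inverse (a + 1 + real n)"
      unfolding f using d(2) set_integral_powr_unit(2)[OF c(1)] set_integral_powr_unit(2)[OF c(2)]
      by (simp only: set_lebesgue_integral_def) (simp add: inverse_eq_divide add_ac)
  qed
  have abs: "\<bar>f n z\<bar> = (if a \<ge> 0 then 1 else -1) * f n z" for n z
  proof (cases "z \<in> {0..1}")
    case True
    have "z powr real n \<ge> z powr (real n + a)" if "a \<ge> 0"
      using that True by (cases "z = 0") (auto intro!: powr_mono')
    moreover have "z powr real n \<le> z powr (real n + a)" if "a < 0"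
      using that True by (cases "z = 0") (auto intro!: powr_mono')
    ultimately show ?thesis using True by (simp add: f_def)
  qed (simp add: f_def)
  have summ: "summable (\<lambda>n. inverse (real (Suc n)) - inverse (a + 1 + real n))"
    using summable_Digamma[of "a + 1"] a by simp
  have 1: "summable (\<lambda>n. \<integral>z. norm (f n z) \<partial>lborel)"
    unfolding real_norm_def abs integral_mult_right_zero val by (rule summable_mult[OF summ])
  have sums: "(\<lambda>n. f n z) sums (indicator {0..1} z * ((1 - z powr a) / (1 - z)))"
    if "z \<noteq> 0" "z \<noteq> 1" for z
  proof (cases "z \<in> {0..1}")
    case True
    then have z: "0 < z" "z < 1" using that by auto
    have "(\<lambda>n. z ^ n * (1 - z powr a)) sums (1 / (1 - z) * (1 - z powr a))"
      using z by (intro sums_mult2 geometric_sums) auto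
    moreover have "f n z = z ^ n * (1 - z powr a)" for n
      using z by (simp add: f_def powr_add powr_realpow algebra_simps)
    ultimately show ?thesis using True by simp
  qed (simp add: f_def)
  have AE: "AE z in lborel. z \<noteq> 0 \<and> z \<noteq> (1::real)"
    using AE_lborel_singleton[of "0::real"] AE_lborel_singleton[of "1::real"] by eventually_elim auto
  have 2: "AE z in lborel. summable (\<lambda>n. norm (f n z))"
    using AE 
  proof eventually_elim
    case (elim z)
    have "summable (\<lambda>n. f n z)" using sums[of z] elim by (blast dest: sums_summable)
    then show ?case unfolding real_norm_def abs by (rule summable_mult)
  qed
  have eq: "AE z in lborel. (\<Sum>n. f n z) = indicator {0..1} z *\<^sub>R ((1 - z powr a) / (1 - z))"
    using AE by eventually_elim (simp add: sums_unique[OF sums, symmetric])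
  have [measurable]: "f n \<in> borel_measurable borel" for n unfolding f_def by measurable
  have "integrable lborel (\<lambda>z. \<Sum>n. f n z)" by (rule integrable_suminf[OF int 2 1])
  with eq show "set_integrable lborel {0..1} (\<lambda>z. (1 - z powr a) / (1 - z))"
    unfolding set_integrable_def by (subst (asm) integrable_cong_AE) auto
  have "(LBINT z:{0..1}. (1 - z powr a) / (1 - z)) = (\<integral>z. (\<Sum>n. f n z) \<partial>lborel)"
    unfolding set_lebesgue_integral_def using eq by (intro integral_cong_AE) auto
  also have "\<dots> = (\<Sum>n. integral\<^sup>L lborel (f n))" by (rule integral_suminf[OF int 2 1])
  also have "\<dots> = Digamma (a + 1) + euler_mascheroni" by (simp add: val Digamma_def)
  finally show "(LBINT z:{0..1}. (1 - z powr a) / (1 - z)) = Digamma (a + 1) + euler_mascheroni" .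
qed

lemma Gamma_reflection_real:
  fixes z :: real
  shows "Gamma z * Gamma (1 - z) = pi / sin (pi * z)"
proof -
  have "complex_of_real (Gamma z * Gamma (1 - z)) = complex_of_real (pi / sin (pi * z))"
    using Gamma_reflection_complex[of "of_real z"] Gamma_complex_of_real[of z]
      Gamma_complex_of_real[of "1 - z"] sin_of_real[of "pi * z", where 'a = complex]
    by simp
  then show ?thesis by (simp only: of_real_eq_iff)
qed

lemma Gamma_one_plus_times_Gamma_one_minus:
  fixes x :: real assumes "x \<noteq> 0"
  shows "x \<notin> \<int>\<^sub>\<le>\<^sub>0 \<Longrightarrow> Gamma (1 + x) * Gamma (1 - x) = pi * x / sin (pi * x)"
  using Gamma_plus1[of x] Gamma_reflection_real[of x] assms by (simp add: add.commute mult.assoc)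

lemma sin_mult_pi_nonzero:
  fixes h :: real assumes "0 < h" "h < 2" "h \<noteq> 1"
  shows "sin (h * pi) \<noteq> 0"
proof
  assume "sin (h * pi) = 0"
  then obtain k :: int where k: "h = of_int k" by (auto simp: sin_zero_iff_int2)
  then have "k = 1" using assms by simp
  with k assms show False by simp
qed

text \<open>
  Euler's reflection formula for \<open>h\<close> and for \<open>b\<close>. The left-hand side is the constant that integration
  by parts produces below, and the right-hand side is the form in which it enters the covariance.
\<close>

lemma Beta_tail_closed_form:
  fixes a b :: real
  defines "h \<equiv> a + b + 1"
  assumes h: "0 < h" "h < 2" "h \<noteq> 1" and b: "-1 < b" "b < 1"
  shows "b * (b - 1) / (h * (h - 1)) * Beta (a + 1) (2 - h) = Beta (a + 1) (b + 1) * sin (b * pi) / sin (h * pi)"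
proof (cases "b = 0")
  case False
  have nz: "sin (h * pi) \<noteq> 0" "sin (b * pi) \<noteq> 0"
    using sin_mult_pi_nonzero[OF h] sin_mult_pi_nonzero[of "b + 1"] b False
    by (auto simp: distrib_right)
  have np: "h \<notin> \<int>\<^sub>\<le>\<^sub>0" "1 - h \<notin> \<int>\<^sub>\<le>\<^sub>0" "b \<notin> \<int>\<^sub>\<le>\<^sub>0" "1 - b \<notin> \<int>\<^sub>\<le>\<^sub>0"
  proof -
    have "sin (x * pi) = 0" if "x \<in> \<int>\<^sub>\<le>\<^sub>0 \<or> 1 - x \<in> \<int>\<^sub>\<le>\<^sub>0" for x :: real
    proof -
      have "x \<in> \<int> \<or> 1 - x \<in> \<int>" using that nonpos_Ints_subset_Ints by blast
      then have "x \<in> \<int>" using Ints_diff[of 1 "1 - x"] by auto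
      then show ?thesis by (simp add: sin_times_pi_eq_0)
    qed
    with nz show "h \<notin> \<int>\<^sub>\<le>\<^sub>0" "1 - h \<notin> \<int>\<^sub>\<le>\<^sub>0" "b \<notin> \<int>\<^sub>\<le>\<^sub>0" "1 - b \<notin> \<int>\<^sub>\<le>\<^sub>0" by blast+
  qed
  have refl: "Gamma (2 - x) * Gamma (x + 1) = x * (1 - x) * pi / sin (x * pi)"
    if "x \<notin> \<int>\<^sub>\<le>\<^sub>0" "1 - x \<notin> \<int>\<^sub>\<le>\<^sub>0" for x :: real
  proof -
    have "Gamma (2 - x) = (1 - x) * Gamma (1 - x)" using Gamma_plus1[OF that(2)] by simp
    then have "Gamma (2 - x) * Gamma (x + 1) = x * (1 - x) * (Gamma x * Gamma (1 - x))"
      using Gamma_plus1[OF that(1)] by (simp add: mult_ac)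
    then show ?thesis using Gamma_reflection_real[of x] by (simp add: mult_ac)
  qed
  define G1 G2 G3 G4 where G: "G1 = Gamma (2 - h)" "G2 = Gamma (h + 1)" "G3 = Gamma (2 - b)" "G4 = Gamma (b + 1)"
  have pos: "G1 > 0" "G2 > 0" "G3 > 0" "G4 > 0"
    unfolding G using h b by (auto intro!: Gamma_real_pos)
  have r: "G1 * G2 * sin (h * pi) = h * (1 - h) * pi" "G3 * G4 * sin (b * pi) = b * (1 - b) * pi"
    using refl[OF np(1,2)] refl[OF np(3,4)] nz unfolding G by (auto simp: field_simps)
  have "(b * (b - 1) * G1) * (G2 * sin (h * pi)) * pi = (h * (h - 1) * G3) * (G4 * sin (b * pi)) * pi"
    using r by algebra
  then have "(b * (b - 1) * G1) * (G2 * sin (h * pi)) = (h * (h - 1) * G3) * (G4 * sin (b * pi))"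
    by simp
  then have "b * (b - 1) * G1 / (h * (h - 1) * G3) = G4 * sin (b * pi) / (G2 * sin (h * pi))"
    using pos h nz by (simp add: frac_eq_eq)
  moreover have e: "a + 1 + (2 - h) = 2 - b" "a + 1 + (b + 1) = h + 1" by (auto simp: h_def)
  ultimately have "Gamma (a + 1) * (b * (b - 1) * G1 / (h * (h - 1) * G3)) =
      Gamma (a + 1) * (G4 * sin (b * pi) / (G2 * sin (h * pi)))"
    by simp
  then show ?thesis unfolding Beta_def e unfolding G by (simp add: mult_ac)
qed simp

text \<open>
  Logarithmic differentiation of \<open>\<Gamma>(1 + x) \<Gamma>(1 - x) = \<pi> x / sin(\<pi> x)\<close>. The factor \<open>a\<close> removes the
  singularity at \<open>a = 0\<close>.
\<close>

lemma Digamma_reflection_scaled: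
  fixes a :: real assumes a: "\<bar>a\<bar> < 1"
  shows "a * (Digamma (1 + a) - Digamma (1 - a)) = 1 - Beta (1 + a) (1 - a) * cos (a * pi)"
proof -
  have Gamma2: "Gamma (2::real) = 1" using Gamma_plus1[of "1::real"] by simp
  show ?thesis
proof (cases "a = 0")
  case True
  then show ?thesis using Gamma2 by (simp add: Beta_def)
next
  case False
  have np: "1 + x \<notin> \<int>\<^sub>\<le>\<^sub>0" "1 - x \<notin> \<int>\<^sub>\<le>\<^sub>0" if "\<bar>x\<bar> < 1" for x :: real
    using that by (auto elim!: nonpos_Ints_cases')
  have sin_nz: "sin (pi * x) \<noteq> 0" if "\<bar>x\<bar> < 1" "x \<noteq> 0" for x
  proof
    assume "sin (pi * x) = 0"
    then obtain k :: int where "x = of_int k" by (auto simp: sin_zero_iff_int2)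
    then show False using that by auto
  qed
  have eq: "Gamma (1 + x) * Gamma (1 - x) = pi * x / sin (pi * x)" if "\<bar>x\<bar> < 1" "x \<noteq> 0" for x :: real
  proof -
    have "x \<notin> \<int>\<^sub>\<le>\<^sub>0" using that by (auto elim!: nonpos_Ints_cases')
    then show ?thesis using Gamma_one_plus_times_Gamma_one_minus[of x] that by simp
  qed
  have "((\<lambda>x. Gamma (1 + x) * Gamma (1 - x)) has_real_derivative
      Gamma (1 + a) * Gamma (1 - a) * (Digamma (1 + a) - Digamma (1 - a))) (at a)"
    using np[OF a] by (auto intro!: derivative_eq_intros simp: algebra_simps)
  moreover have ev: "\<forall>\<^sub>F x in nhds a. Gamma (1 + x) * Gamma (1 - x) = pi * x / sin (pi * x)"
  proof -
    have "open ({-1<..<1} - {0::real})" by (intro open_Diff) auto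
    moreover have "a \<in> {-1<..<1} - {0}" using a False by auto
    ultimately have "\<forall>\<^sub>F x in nhds a. x \<in> {-1<..<1} - {0}" by (rule eventually_nhds_in_open)
    then show ?thesis by eventually_elim (rule eq, auto)
  qed
  have "((\<lambda>x. pi * x / sin (pi * x)) has_real_derivative
      (pi * sin (pi * a) - pi * a * (pi * cos (pi * a))) / (sin (pi * a))\<^sup>2) (at a)"
    using sin_nz[OF a False] by (auto intro!: derivative_eq_intros simp: power2_eq_square)
  then have "((\<lambda>x. Gamma (1 + x) * Gamma (1 - x)) has_real_derivative
      (pi * sin (pi * a) - pi * a * (pi * cos (pi * a))) / (sin (pi * a))\<^sup>2) (at a)"
    by (subst DERIV_cong_ev[OF refl ev refl])
  ultimately have "pi * a / sin (pi * a) * (Digamma (1 + a) - Digamma (1 - a)) =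
      (pi * sin (pi * a) - pi * a * (pi * cos (pi * a))) / (sin (pi * a))\<^sup>2"
    using DERIV_unique eq[OF a False] by metis
  moreover have "A * D = pi - A * (pi * C) / S" if "A / S * D = (pi * S - A * (pi * C)) / S\<^sup>2" "S \<noteq> 0" for A S C D :: real
  proof -
    have "A * D = A / S * D * S" using that(2) by simp
    also have "\<dots> = (pi * S - A * (pi * C)) / S" unfolding that(1) using that(2) by (simp add: power2_eq_square)
    finally show ?thesis using that(2) by (simp add: diff_divide_distrib)
  qed
  ultimately have "pi * a * (Digamma (1 + a) - Digamma (1 - a)) = pi - pi * a * (pi * cos (pi * a)) / sin (pi * a)"
    using sin_nz[OF a False] by blast
  then have "pi * (a * (Digamma (1 + a) - Digamma (1 - a))) = pi * (1 - pi * a / sin (pi * a) * cos (pi * a))"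
    by (simp add: right_diff_distrib mult_ac)
  moreover have "Beta (1 + a) (1 - a) = pi * a / sin (pi * a)"
    using eq[OF a False] Gamma2 by (simp add: Beta_def)
  ultimately show ?thesis by (simp add: mult.commute)
qed
qed

section \<open>Second-order expansion of powers\<close>

lemma powr_one_plus_slope:
  fixes p :: real
  shows "((\<lambda>u. ((1 + u) powr p - 1) / u) \<longlongrightarrow> p) (at 0)"
proof -
  have "((\<lambda>u. (1 + u) powr p) has_real_derivative p * (1 + 0) powr (p - 1)) (at 0)"
    by (auto intro!: derivative_eq_intros)
  then show ?thesis by (simp add: has_field_derivative_def DERIV_def flip: has_field_derivative_def)
qed

lemma powr_one_plus_second_order:
  fixes p :: real
  shows "((\<lambda>u. ((1 + u) powr p - 1 - p * u) / u\<^sup>2) \<longlongrightarrow> p * (p - 1) / 2) (at 0)"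
proof (rule lhopital)
  have small: "\<forall>\<^sub>F u in at 0. \<bar>u\<bar> < (1::real)"
    using eventually_at_ball'[of 1 "0::real" UNIV] by (auto simp: dist_real_def elim: eventually_mono)
  show "((\<lambda>u. (1 + u) powr p - 1 - p * u) \<longlongrightarrow> 0) (at 0)"
    by (auto intro!: tendsto_eq_intros)
  show "((\<lambda>u::real. u\<^sup>2) \<longlongrightarrow> 0) (at 0)" by (auto intro!: tendsto_eq_intros)
  show "\<forall>\<^sub>F u in at 0. (u::real)\<^sup>2 \<noteq> 0" "\<forall>\<^sub>F u in at 0. 2 * (u::real) \<noteq> 0"
    by (auto simp: eventually_at_filter)
  show "\<forall>\<^sub>F u in at 0. ((\<lambda>u. (1 + u) powr p - 1 - p * u) has_real_derivative
      p * (1 + u) powr (p - 1) - p) (at u)"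
    using small by eventually_elim (auto intro!: derivative_eq_intros)
  show "\<forall>\<^sub>F u in at 0. ((\<lambda>u::real. u\<^sup>2) has_real_derivative 2 * u) (at u)"
    by (auto intro!: always_eventually derivative_eq_intros)
  have "((\<lambda>u. p / 2 * (((1 + u) powr (p - 1) - 1) / u)) \<longlongrightarrow> p / 2 * (p - 1)) (at 0)"
    by (intro tendsto_intros powr_one_plus_slope)
  then show "((\<lambda>u. (p * (1 + u) powr (p - 1) - p) / (2 * u)) \<longlongrightarrow> p * (p - 1) / 2) (at 0)"
    by (simp add: field_simps)
qed

text \<open>
  The exponent \<open>q\<close> will be the growth exponent \<open>h\<close> of a truncated integral. As \<open>h < 2\<close>, a second-order
  error of relative size \<open>N\<^sup>-\<^sup>2\<close> is negligible, while the first-order term has to be kept.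
\<close>

lemma powr_shift_second_order:
  fixes p q s :: real assumes "q < 2"
  shows "((\<lambda>N. N powr q * ((1 + s / N) powr p - 1 - p * (s / N))) \<longlongrightarrow> 0) at_top"
proof (cases "s = 0")
  case False
  have "filterlim (\<lambda>N. s / N) (at 0) at_top"
    unfolding filterlim_at using False
    by (auto intro!: tendsto_eq_intros real_tendsto_divide_at_top filterlim_ident
        eventually_mono[OF eventually_gt_at_top[of 0]])
  note * = filterlim_compose[OF powr_one_plus_second_order[of p] this]
  have "((\<lambda>N. s\<^sup>2 * N powr (q - 2) * (((1 + s / N) powr p - 1 - p * (s / N)) / (s / N)\<^sup>2)) \<longlongrightarrow> s\<^sup>2 * 0 * (p * (p - 1) / 2)) at_top"
    using assms by (intro tendsto_intros * tendsto_neg_powr filterlim_ident) auto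
  then have "((\<lambda>N. s\<^sup>2 * N powr (q - 2) * (((1 + s / N) powr p - 1 - p * (s / N)) / (s / N)\<^sup>2)) \<longlongrightarrow> 0) at_top" by simp
  then show ?thesis
  proof (rule Lim_transform_eventually)
    show "\<forall>\<^sub>F N in at_top. s\<^sup>2 * N powr (q - 2) * (((1 + s / N) powr p - 1 - p * (s / N)) / (s / N)\<^sup>2)
       = N powr q * ((1 + s / N) powr p - 1 - p * (s / N))"
      using eventually_gt_at_top[of 0]
    proof eventually_elim
      case (elim N)
      have "N powr q = N powr (q - 2) * N\<^sup>2"
        using elim by (simp add: powr_diff)
      then show ?case using elim False by (simp add: power_divide)
    qed
  qed
qed simp

lemma powr_shift_first_order:
  fixes p q s :: real assumes "q < 1"
  shows "((\<lambda>N. N powr q * ((1 + s / N) powr p - 1)) \<longlongrightarrow> 0) at_top"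
proof -
  have "((\<lambda>N. N powr q * ((1 + s / N) powr p - 1 - p * (s / N)) + p * s * N powr (q - 1)) \<longlongrightarrow> 0 + p * s * 0) at_top"
    using assms by (intro tendsto_intros powr_shift_second_order tendsto_neg_powr filterlim_ident) auto
  then have "((\<lambda>N. N powr q * ((1 + s / N) powr p - 1 - p * (s / N)) + p * s * N powr (q - 1)) \<longlongrightarrow> 0) at_top"
    by simp
  then show ?thesis
    by (rule Lim_transform_eventually)
      (auto intro!: eventually_mono[OF eventually_gt_at_top[of 0]] simp: powr_diff field_simps)
qed

section \<open>Truncated Beta integrals\<close>

definition trunc_Beta :: "real \<Rightarrow> real \<Rightarrow> real \<Rightarrow> real" where
  "trunc_Beta a b N = (LBINT y:{0..N}. y powr a * (y + 1) powr b)"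

text \<open>
  The substitution \<open>z = y / (y + 1)\<close> maps the half-line onto the unit interval, so that the truncated
  integrals below converge to integrals over \<open>{0..1}\<close>.
\<close>

lemma unit_substitution:
  fixes f :: "real \<Rightarrow> real"
  assumes f: "set_integrable lborel {0..1} f"
  shows "N \<ge> 0 \<Longrightarrow> set_integrable lborel {0..N} (\<lambda>y. f (y / (y + 1)) / (y + 1)\<^sup>2)"
    and "((\<lambda>N. LBINT y:{0..N}. f (y / (y + 1)) / (y + 1)\<^sup>2) \<longlongrightarrow> (LBINT z:{0..1}. f z)) at_top"
proof -
  have sub: "set_integrable lborel {0..N} (\<lambda>y. f (y / (y + 1)) / (y + 1)\<^sup>2)"
    "(LBINT y:{0..N}. f (y / (y + 1)) / (y + 1)\<^sup>2) = integral {0..N / (N + 1)} f" if N: "N \<ge> 0" for N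
  proof -
    have g: "((\<lambda>y. y / (y + 1)) has_real_derivative 1 / (y + 1)\<^sup>2) (at y)" if "y \<in> {0..N}" for y
      using that by (auto intro!: derivative_eq_intros simp: power2_eq_square)
    have c: "continuous_on {0..N} (\<lambda>y. 1 / (y + 1)\<^sup>2)"
      by (auto intro!: continuous_intros)
    have fi: "set_integrable lborel {0 / (0 + 1)..N / (N + 1)} f"
      by (rule set_integrable_subset[OF f]) (use N in auto)
    note s = integral_substitution[OF fi g c _ N]
    show "set_integrable lborel {0..N} (\<lambda>y. f (y / (y + 1)) / (y + 1)\<^sup>2)"
      using s(1) by simp
    have "(LBINT y:{0..N}. f (y / (y + 1)) / (y + 1)\<^sup>2) = (LBINT z:{0..N / (N + 1)}. f z)"
      using s(2) by (simp add: set_lebesgue_integral_def mult.commute)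
    then show "(LBINT y:{0..N}. f (y / (y + 1)) / (y + 1)\<^sup>2) = integral {0..N / (N + 1)} f"
      using set_borel_integral_eq_integral(2)[OF fi] by simp
  qed
  show "N \<ge> 0 \<Longrightarrow> set_integrable lborel {0..N} (\<lambda>y. f (y / (y + 1)) / (y + 1)\<^sup>2)"
    by (rule sub)
  have "continuous_on {0..1} (\<lambda>x. integral {0..x} f)"
    by (intro indefinite_integral_continuous_1 set_borel_integral_eq_integral(1) f)
  then have "((\<lambda>x. integral {0..x} f) \<longlongrightarrow> integral {0..1} f) (at 1 within {0..1})"
    by (simp add: continuous_on_def)
  moreover have "filterlim (\<lambda>N::real. N / (N + 1)) (at 1 within {0..1}) at_top"
    unfolding filterlim_at
  proof
    show "\<forall>\<^sub>F N in at_top. N / (N + 1) \<in> {0..1} \<and> N / (N + 1) \<noteq> (1::real)"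
      using eventually_gt_at_top[of 0] by eventually_elim auto
    show "((\<lambda>N::real. N / (N + 1)) \<longlongrightarrow> 1) at_top" by real_asymp
  qed
  ultimately have "((\<lambda>N. integral {0..N / (N + 1)} f) \<longlongrightarrow> integral {0..1} f) at_top"
    by (rule filterlim_compose)
  moreover have "(LBINT z:{0..1}. f z) = integral {0..1} f"
    by (rule set_borel_integral_eq_integral(2)[OF f])
  ultimately have "((\<lambda>N. integral {0..N / (N + 1)} f) \<longlongrightarrow> (LBINT z:{0..1}. f z)) at_top"
    by simp
  then show "((\<lambda>N. LBINT y:{0..N}. f (y / (y + 1)) / (y + 1)\<^sup>2) \<longlongrightarrow> (LBINT z:{0..1}. f z)) at_top"
    by (rule Lim_transform_eventually)
      (rule eventually_mono[OF eventually_ge_at_top[of 0]], simp only: sub(2))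
qed

lemma set_integrable_powr_shift:
  fixes a b N :: real assumes "a > -1" "N \<ge> 0"
  shows "set_integrable lborel {0..N} (\<lambda>y. y powr a * (y + 1) powr b)"
proof -
  have "set_integrable lborel {0..N} (\<lambda>y. y powr a)"
    using nonneg_has_integral_imp_set_integral(1)[OF _ _ _ has_integral_powr_from_0[OF assms]] by simp
  then have "set_integrable lborel {0..N} (\<lambda>y. (N + 1) powr \<bar>b\<bar> * y powr a)"
    by (rule set_integrable_mult_right)
  then show ?thesis
  proof (rule set_integrable_bound)
    show "AE y in lborel. y \<in> {0..N} \<longrightarrow> norm (y powr a * (y + 1) powr b) \<le> norm ((N + 1) powr \<bar>b\<bar> * y powr a)"
    proof (intro AE_I2 impI)
      fix y assume y: "y \<in> {0..N}"
      have "(y + 1) powr b \<le> (y + 1) powr \<bar>b\<bar>" using y by (intro powr_mono) auto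
      also have "\<dots> \<le> (N + 1) powr \<bar>b\<bar>" using y by (intro powr_mono2) auto
      finally show "norm (y powr a * (y + 1) powr b) \<le> norm ((N + 1) powr \<bar>b\<bar> * y powr a)"
        by (simp add: mult.commute mult_left_mono)
    qed
  qed (simp add: set_borel_measurable_def)
qed

text \<open>
  Integration by parts with the primitive \<open>y\<^sup>a\<^sup>+\<^sup>1 (y + 1)\<^sup>b\<close>, where \<open>y\<close> is rewritten as \<open>(y + 1) - 1\<close>. It
  lowers the growth exponent at infinity by one.
\<close>

lemma trunc_Beta_recurrence:
  fixes a b N :: real assumes a: "a > -1" and N: "N \<ge> 0"
  shows "(a + b + 1) * trunc_Beta a b N = N powr (a + 1) * (N + 1) powr b + b * trunc_Beta a (b - 1) N"
proof -
  define P where "P y = y powr (a + 1) * (y + 1) powr b" for y :: real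
  have "((\<lambda>y. (a + b + 1) * (y powr a * (y + 1) powr b) - b * (y powr a * (y + 1) powr (b - 1)))
      has_integral (P N - P 0)) {0..N}"
  proof (rule fundamental_theorem_of_calculus_interior[OF N])
    show "continuous_on {0..N} P"
      unfolding P_def using a by (intro continuous_on_mult continuous_on_powr' continuous_intros) auto
    fix y assume y: "y \<in> {0<..<N}"
    have "(P has_real_derivative ((a + 1) * y powr a * (y + 1) powr b + y powr (a + 1) * (b * (y + 1) powr (b - 1)))) (at y)"
      unfolding P_def using y by (auto intro!: derivative_eq_intros)
    moreover have "(y + 1) powr b = (y + 1) * (y + 1) powr (b - 1)" "y powr (a + 1) = y * y powr a"
      using y by (auto simp: powr_diff powr_add)
    ultimately have "(P has_real_derivative ((a + b + 1) * (y powr a * ((y + 1) * (y + 1) powr (b - 1))) - b * (y powr a * (y + 1) powr (b - 1)))) (at y)"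
      by (simp add: algebra_simps)
    then show "(P has_vector_derivative (a + b + 1) * (y powr a * (y + 1) powr b) - b * (y powr a * (y + 1) powr (b - 1))) (at y)"
      using y by (simp add: has_real_derivative_iff_has_vector_derivative powr_diff)
  qed
  moreover have "((\<lambda>y. (a + b + 1) * (y powr a * (y + 1) powr b) - b * (y powr a * (y + 1) powr (b - 1)))
      has_integral ((a + b + 1) * trunc_Beta a b N - b * trunc_Beta a (b - 1) N)) {0..N}"
    unfolding trunc_Beta_def set_borel_integral_eq_integral(2)[OF set_integrable_powr_shift[OF assms]]
    by (intro has_integral_diff has_integral_mult_right integrable_integral
        set_borel_integral_eq_integral(1) set_integrable_powr_shift assms)
  ultimately have "P N - P 0 = (a + b + 1) * trunc_Beta a b N - b * trunc_Beta a (b - 1) N"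
    by (rule has_integral_unique)
  then show ?thesis using a by (simp add: P_def)
qed

lemma trunc_Beta_tendsto_Beta:
  fixes a b :: real assumes a: "a > -1" and ab: "a + b < -1"
  shows "(trunc_Beta a b \<longlongrightarrow> Beta (a + 1) (- a - b - 1)) at_top"
proof -
  let ?f = "\<lambda>z::real. z powr a * (1 - z) powr (- a - b - 2)"
  have f: "set_integrable lborel {0..1} ?f"
    using integrable_Beta[of "a + 1" "- a - b - 1"] a ab by simp
  have B: "(LBINT z:{0..1}. ?f z) = Beta (a + 1) (- a - b - 1)"
    using has_integral_Beta_real[of "a + 1" "- a - b - 1"] a ab set_borel_integral_eq_integral(2)[OF f]
    by (simp add: integral_unique)
  have eq: "?f (y / (y + 1)) / (y + 1)\<^sup>2 = y powr a * (y + 1) powr b" if "y \<ge> 0" for y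
  proof -
    have 1: "1 - y / (y + 1) = 1 / (y + 1)" using that by (simp add: field_simps)
    have 2: "(1 / (y + 1)) powr (- a - b - 2) = (y + 1) powr (a + b + 2)"
    proof -
      have "(1 / (y + 1)) powr (- a - b - 2) = 1 / (y + 1) powr (- (a + b + 2))"
        using that by (simp add: powr_divide)
      then show ?thesis by (simp only: powr_minus inverse_eq_divide) simp
    qed
    have "?f (y / (y + 1)) / (y + 1)\<^sup>2 = y powr a * ((y + 1) powr (- a) * (y + 1) powr (a + b + 2) * (y + 1) powr (-2))"
      unfolding 1 2 using that by (simp add: powr_divide powr_minus_divide)
    also have "(y + 1) powr (- a) * (y + 1) powr (a + b + 2) * (y + 1) powr (-2) = (y + 1) powr b"
      by (simp flip: powr_add)
    finally show ?thesis .
  qed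
  have "(LBINT y:{0..N}. ?f (y / (y + 1)) / (y + 1)\<^sup>2) = trunc_Beta a b N" for N
    unfolding trunc_Beta_def by (rule set_lebesgue_integral_cong) (use eq in auto)
  then show ?thesis using unit_substitution(2)[OF f] B by simp
qed

text \<open>
  Here the integrand decays like \<open>1 / y\<close>. Subtracting \<open>1 / (y + 1)\<close> leaves, after the substitution, the
  integral of the Digamma function.
\<close>

lemma trunc_Beta_log_asymptotics:
  fixes a :: real assumes a: "a > -1"
  shows "((\<lambda>N. trunc_Beta a (- a - 1) N - ln N) \<longlongrightarrow> - (Digamma (a + 1) + euler_mascheroni)) at_top"
proof -
  let ?f = "\<lambda>z::real. (1 - z powr a) / (1 - z)"
  note f = Digamma_integral[OF a]
  have eq: "?f (y / (y + 1)) / (y + 1)\<^sup>2 = 1 / (y + 1) - y powr a * (y + 1) powr (- a - 1)" if "y \<ge> 0" for y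
  proof -
    have 1: "1 - y / (y + 1) = 1 / (y + 1)" using that by (simp add: field_simps)
    have "?f (y / (y + 1)) / (y + 1)\<^sup>2 = (1 - y powr a / (y + 1) powr a) / (y + 1)"
      unfolding 1 using that by (simp add: powr_divide power2_eq_square)
    also have "\<dots> = 1 / (y + 1) - y powr a * (y + 1) powr (- a - 1)"
      using that by (simp add: powr_diff powr_minus_divide diff_divide_distrib)
    finally show ?thesis .
  qed
  have log: "set_integrable lborel {0..N} (\<lambda>y. 1 / (y + 1))" "(LBINT y:{0..N}. 1 / (y + 1)) = ln (N + 1)" if "N \<ge> 0" for N :: real
  proof -
    have "((\<lambda>y. 1 / (y + 1)) has_integral ln (N + 1) - ln (0 + 1)) {0..N}"
      using that by (intro fundamental_theorem_of_calculus)
        (auto intro!: derivative_eq_intros simp flip: has_real_derivative_iff_has_vector_derivative)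
    from nonneg_has_integral_imp_set_integral[OF _ _ _ this]
    show "set_integrable lborel {0..N} (\<lambda>y. 1 / (y + 1))" "(LBINT y:{0..N}. 1 / (y + 1)) = ln (N + 1)"
      by auto
  qed
  have int: "(LBINT y:{0..N}. ?f (y / (y + 1)) / (y + 1)\<^sup>2) = ln (N + 1) - trunc_Beta a (- a - 1) N" if N: "N \<ge> 0" for N
  proof -
    have "(LBINT y:{0..N}. ?f (y / (y + 1)) / (y + 1)\<^sup>2) = (LBINT y:{0..N}. 1 / (y + 1) - y powr a * (y + 1) powr (- a - 1))"
      by (rule set_lebesgue_integral_cong) (use eq in auto)
    also have "\<dots> = ln (N + 1) - trunc_Beta a (- a - 1) N"
      unfolding trunc_Beta_def using set_integral_diff(2)[OF log(1)[OF N] set_integrable_powr_shift[OF a N]] log(2)[OF N] by simp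
    finally show ?thesis .
  qed
  have "((\<lambda>N. ln (N + 1) - trunc_Beta a (- a - 1) N) \<longlongrightarrow> Digamma (a + 1) + euler_mascheroni) at_top"
    using unit_substitution(2)[OF f(1)] unfolding f(2)
    by (rule Lim_transform_eventually) (rule eventually_mono[OF eventually_ge_at_top[of 0]], simp only: int)
  moreover have "((\<lambda>N::real. ln (N + 1) - ln N) \<longlongrightarrow> 0) at_top"
    by real_asymp
  ultimately have "((\<lambda>N. (ln (N + 1) - ln N) - (ln (N + 1) - trunc_Beta a (- a - 1) N)) \<longlongrightarrow> 0 - (Digamma (a + 1) + euler_mascheroni)) at_top"
    by (intro tendsto_diff)
  then show ?thesis by simp
qed

text \<open>
  Two applications of the recurrence reduce to the exponents \<open>(a, b - 2)\<close>, whose integral converges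
  because \<open>h < 2\<close>. The boundary terms are expanded to the order that survives as \<open>N\<close> grows.
\<close>

lemma trunc_Beta_asymptotics:
  fixes a b :: real
  defines "h \<equiv> a + b + 1"
  assumes a: "-1 < a" and b: "-1 < b" "b < 1" and h: "0 < h" "h < 2" "h \<noteq> 1"
  shows "((\<lambda>N. trunc_Beta a b N - N powr h / h - b * N powr (h - 1) / (h - 1)) \<longlongrightarrow>
    Beta (a + 1) (b + 1) * sin (b * pi) / sin (h * pi)) at_top"
proof -
  have B: "(trunc_Beta a (b - 2) \<longlongrightarrow> Beta (a + 1) (2 - h)) at_top"
    using trunc_Beta_tendsto_Beta[of a "b - 2"] a h by (simp add: h_def algebra_simps)
  have s2: "((\<lambda>N. N powr h * ((1 + 1 / N) powr b - 1 - b * (1 / N))) \<longlongrightarrow> 0) at_top"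
    by (rule powr_shift_second_order) (use h in auto)
  have s1: "((\<lambda>N. N powr (h - 1) * ((1 + 1 / N) powr (b - 1) - 1)) \<longlongrightarrow> 0) at_top"
    by (rule powr_shift_first_order) (use h in auto)
  \<comment> \<open>What the two recurrences leave once the divergent part is removed: the expansion errors of the two
    boundary terms and a multiple of the convergent integral.\<close>
  have "((\<lambda>N. N powr h * ((1 + 1 / N) powr b - 1 - b * (1 / N)) / h +
      b / (h * (h - 1)) * (N powr (h - 1) * ((1 + 1 / N) powr (b - 1) - 1)) +
      b * (b - 1) / (h * (h - 1)) * trunc_Beta a (b - 2) N) \<longlongrightarrow>
      0 / h + b / (h * (h - 1)) * 0 + b * (b - 1) / (h * (h - 1)) * Beta (a + 1) (2 - h)) at_top"
    by (intro tendsto_intros s1 s2 B) (use h in auto)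
  then have "((\<lambda>N. N powr h * ((1 + 1 / N) powr b - 1 - b * (1 / N)) / h +
      b / (h * (h - 1)) * (N powr (h - 1) * ((1 + 1 / N) powr (b - 1) - 1)) +
      b * (b - 1) / (h * (h - 1)) * trunc_Beta a (b - 2) N) \<longlongrightarrow>
      Beta (a + 1) (b + 1) * sin (b * pi) / sin (h * pi)) at_top"
    using Beta_tail_closed_form[of a b] h b unfolding h_def by simp
  then show ?thesis
  proof (rule Lim_transform_eventually, intro eventually_mono[OF eventually_gt_at_top[of 0]])
    fix N :: real assume N: "N > 0"
    define Q1 Q2 where Q: "Q1 = (1 + 1 / N) powr b" "Q2 = (1 + 1 / N) powr (b - 1)"
    have p: "N powr (a + 1) * (N + 1) powr c = N powr (a + 1 + c) * (1 + 1 / N) powr c" for c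
    proof -
      have "N + 1 = N * (1 + 1 / N)" using N by (simp add: field_simps)
      then have "(N + 1) powr c = N powr c * (1 + 1 / N) powr c"
        using N by (simp only: powr_mult)
      then show ?thesis by (simp add: powr_add)
    qed
    have r1: "h * trunc_Beta a b N = N powr h * Q1 + b * trunc_Beta a (b - 1) N"
      using trunc_Beta_recurrence[OF a, of N b] N p[of b] unfolding Q h_def by (simp add: add_ac)
    have r2: "(h - 1) * trunc_Beta a (b - 1) N = N powr (h - 1) * Q2 + (b - 1) * trunc_Beta a (b - 2) N"
      using trunc_Beta_recurrence[OF a, of N "b - 1"] N p[of "b - 1"] unfolding Q h_def by (simp add: algebra_simps)
    have e1: "trunc_Beta a b N = (N powr h * Q1 + b * trunc_Beta a (b - 1) N) / h"
      using r1 h by (simp add: field_simps)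
    have e2: "trunc_Beta a (b - 1) N = (N powr (h - 1) * Q2 + (b - 1) * trunc_Beta a (b - 2) N) / (h - 1)"
      using r2 h by (simp add: field_simps)
    have e3: "N powr h = N * N powr (h - 1)" using N by (simp add: powr_diff)
    have h1: "h - 1 \<noteq> 0" "h \<noteq> 0" using h by auto
    show "N powr h * ((1 + 1 / N) powr b - 1 - b * (1 / N)) / h +
      b / (h * (h - 1)) * (N powr (h - 1) * ((1 + 1 / N) powr (b - 1) - 1)) +
      b * (b - 1) / (h * (h - 1)) * trunc_Beta a (b - 2) N =
      trunc_Beta a b N - N powr h / h - b * N powr (h - 1) / (h - 1)"
      unfolding e1 e2 e3 Q[symmetric] using h1 N by (simp add: divide_simps) (simp add: algebra_simps)
  qed
qed

text \<open>
  The case \<open>h = 1\<close>: a single application of the recurrence, followed by the logarithmic asymptotics.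
\<close>

lemma trunc_Beta_asymptotics_critical:
  fixes a :: real
  assumes a: "-1 < a"
  shows "((\<lambda>N. trunc_Beta a (- a) N - N + a * ln N) \<longlongrightarrow>
    - a + a * (Digamma (a + 1) + euler_mascheroni)) at_top"
proof -
  have s: "((\<lambda>N. N powr 1 * ((1 + 1 / N) powr (- a) - 1 - (- a) * (1 / N))) \<longlongrightarrow> 0) at_top"
    by (rule powr_shift_second_order) auto
  have "((\<lambda>N. N powr 1 * ((1 + 1 / N) powr (- a) - 1 - (- a) * (1 / N)) - a
       - a * (trunc_Beta a (- a - 1) N - ln N)) \<longlongrightarrow> 0 - a - a * (- (Digamma (a + 1) + euler_mascheroni))) at_top"
    by (intro tendsto_intros s trunc_Beta_log_asymptotics a)
  then have "((\<lambda>N. N powr 1 * ((1 + 1 / N) powr (- a) - 1 - (- a) * (1 / N)) - a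
       - a * (trunc_Beta a (- a - 1) N - ln N)) \<longlongrightarrow> - a + a * (Digamma (a + 1) + euler_mascheroni)) at_top"
    by (simp only: diff_0 mult_minus_right diff_minus_eq_add)
  then show ?thesis
  proof (rule Lim_transform_eventually, intro eventually_mono[OF eventually_gt_at_top[of 0]])
    fix N :: real assume N: "N > 0"
    have p: "N powr (a + 1) * (N + 1) powr (- a) = N * (1 + 1 / N) powr (- a)"
    proof -
      have "N + 1 = N * (1 + 1 / N)" using N by (simp add: field_simps)
      then have "(N + 1) powr (- a) = N powr (- a) * (1 + 1 / N) powr (- a)"
        using N by (simp only: powr_mult)
      moreover have "N powr (a + 1) * N powr (- a) = N" using N by (simp flip: powr_add)
      ultimately show ?thesis by (simp flip: mult.assoc)
    qed
    have r1: "trunc_Beta a (- a) N = N * (1 + 1 / N) powr (- a) - a * trunc_Beta a (- a - 1) N"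
      using trunc_Beta_recurrence[OF a, of N "- a"] N p by simp
    show "N powr 1 * ((1 + 1 / N) powr (- a) - 1 - (- a) * (1 / N)) - a
       - a * (trunc_Beta a (- a - 1) N - ln N) = trunc_Beta a (- a) N - N + a * ln N"
      unfolding r1 using N by (simp add: algebra_simps)
  qed
qed

section \<open>Inner products of shifted powers\<close>

lemma trunc_Beta_scaled:
  fixes a b u N :: real assumes a: "a > -1" and u: "u > 0" and N: "N \<ge> 0"
  shows "set_integrable lborel {0..N} (\<lambda>y. y powr a * (y + u) powr b)"
    and "(LBINT y:{0..N}. y powr a * (y + u) powr b) = u powr (a + b + 1) * trunc_Beta a b (N / u)"
proof -
  let ?f = "\<lambda>y. indicator {0..N} y *\<^sub>R (y powr a * (y + u) powr b)"
  have eq: "?f (0 + u * z) = u powr (a + b) * (indicator {0..N / u} z *\<^sub>R (z powr a * (z + 1) powr b))" for z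
  proof (cases "z \<in> {0..N / u}")
    case True
    then have "u * z + u = u * (z + 1)" "0 \<le> u * z" "u * z \<le> N" using u by (auto simp: field_simps)
    then show ?thesis using True u by (simp add: powr_mult powr_add)
  next
    case False
    then show ?thesis using u by (auto simp: field_simps indicator_def mult_less_0_iff zero_le_mult_iff)
  qed
  have "integrable lborel (\<lambda>z. ?f (0 + u * z))"
    unfolding eq using set_integrable_powr_shift[OF a, of "N / u" b] N u
    by (intro integrable_mult_right) (simp add: set_integrable_def)
  then show "set_integrable lborel {0..N} (\<lambda>y. y powr a * (y + u) powr b)"
    unfolding set_integrable_def using lborel_integrable_real_affine_iff[of u ?f 0] u by simp
  have "(LBINT y:{0..N}. y powr a * (y + u) powr b) = \<bar>u\<bar> *\<^sub>R (\<integral>z. ?f (0 + u * z) \<partial>lborel)"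
    unfolding set_lebesgue_integral_def using u by (intro lborel_integral_real_affine) auto
  also have "\<dots> = u powr (a + b + 1) * trunc_Beta a b (N / u)"
    unfolding eq integral_mult_right_zero using u by (simp add: trunc_Beta_def set_lebesgue_integral_def powr_add)
  finally show "(LBINT y:{0..N}. y powr a * (y + u) powr b) = u powr (a + b + 1) * trunc_Beta a b (N / u)" .
qed

definition trunc_inner :: "real \<Rightarrow> real \<Rightarrow> real \<Rightarrow> real \<Rightarrow> real \<Rightarrow> real" where
  "trunc_inner a b s t N = (LBINT y:{..N}. pos_part (y + s) powr a * pos_part (y + t) powr b)"

lemma trunc_inner_commute: "trunc_inner a b s t = trunc_inner b a t s"
  by (simp add: trunc_inner_def fun_eq_iff mult.commute)

lemma pos_part_measurable [measurable]: "pos_part \<in> borel_measurable borel"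
  unfolding pos_part_def by measurable

text \<open>
  The substitution \<open>y = z - s\<close>. Below \<open>z = 0\<close> the factor with the smaller shift vanishes.
\<close>

lemma trunc_inner_translate:
  fixes a b s t N :: real assumes st: "s \<le> t"
  shows "set_integrable lborel {..N} (\<lambda>y. pos_part (y + s) powr a * pos_part (y + t) powr b) \<longleftrightarrow>
      set_integrable lborel {0..N + s} (\<lambda>y. y powr a * (y + (t - s)) powr b)"
    and "trunc_inner a b s t N = (LBINT y:{0..N + s}. y powr a * (y + (t - s)) powr b)"
proof -
  let ?f = "\<lambda>y. indicator {..N} y *\<^sub>R (pos_part (y + s) powr a * pos_part (y + t) powr b)"
  have eq: "?f (- s + 1 * z) = indicator {0..N + s} z *\<^sub>R (z powr a * (z + (t - s)) powr b)" for z
    using st by (auto simp: indicator_def pos_part_def max_def algebra_simps)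
  show "set_integrable lborel {..N} (\<lambda>y. pos_part (y + s) powr a * pos_part (y + t) powr b) \<longleftrightarrow>
      set_integrable lborel {0..N + s} (\<lambda>y. y powr a * (y + (t - s)) powr b)"
    unfolding set_integrable_def using lborel_integrable_real_affine_iff[of 1 ?f "- s"] unfolding eq by simp
  show "trunc_inner a b s t N = (LBINT y:{0..N + s}. y powr a * (y + (t - s)) powr b)"
    unfolding trunc_inner_def set_lebesgue_integral_def using lborel_integral_real_affine[of 1 ?f "- s"] unfolding eq by simp
qed

lemma trunc_inner_diagonal:
  fixes a b s N :: real assumes ab: "a + b > -1" and N: "N + s \<ge> 0"
  shows "set_integrable lborel {..N} (\<lambda>y. pos_part (y + s) powr a * pos_part (y + s) powr b)"
    and "trunc_inner a b s s N = (N + s) powr (a + b + 1) / (a + b + 1)"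
proof -
  have eq: "y powr a * (y + (s - s)) powr b = y powr (a + b)" for y :: real
    by (simp flip: powr_add)
  note i = nonneg_has_integral_imp_set_integral[OF _ _ _ has_integral_powr_from_0[OF ab N]]
  show "set_integrable lborel {..N} (\<lambda>y. pos_part (y + s) powr a * pos_part (y + s) powr b)"
    unfolding trunc_inner_translate(1)[OF order_refl] eq using i by simp
  show "trunc_inner a b s s N = (N + s) powr (a + b + 1) / (a + b + 1)"
    unfolding trunc_inner_translate(2)[OF order_refl] eq using i by simp
qed

lemma trunc_inner_off_diagonal:
  fixes a b s t N :: real assumes a: "a > -1" and st: "s < t" and N: "N + s \<ge> 0"
  shows "set_integrable lborel {..N} (\<lambda>y. pos_part (y + s) powr a * pos_part (y + t) powr b)"
    and "trunc_inner a b s t N = (t - s) powr (a + b + 1) * trunc_Beta a b ((N + s) / (t - s))"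
  using trunc_Beta_scaled[of a "t - s" "N + s" b] assms by (simp_all add: trunc_inner_translate)

lemma trunc_inner_integrable:
  fixes a b s t N :: real assumes a: "a > -1" and b: "b > -1" and ab: "a + b > -1"
  shows "set_integrable lborel {..N} (\<lambda>y. pos_part (y + s) powr a * pos_part (y + t) powr b)"
proof -
  \<comment> \<open>Enlarging the truncation level makes the range of integration non-empty after the translation.\<close>
  define N' where "N' = max N (max (- s) (- t))"
  have N': "N' + s \<ge> 0" "N' + t \<ge> 0" "N \<le> N'" by (auto simp: N'_def)
  have "set_integrable lborel {..N'} (\<lambda>y. pos_part (y + s) powr a * pos_part (y + t) powr b)"
  proof (cases s t rule: linorder_cases)
    case less then show ?thesis by (rule trunc_inner_off_diagonal(1)[OF a _ N'(1)])
  next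
    case equal then show ?thesis using trunc_inner_diagonal(1)[OF ab N'(1)] by simp
  next
    case greater then show ?thesis using trunc_inner_off_diagonal(1)[OF b _ N'(2), of s a] by (simp add: mult.commute)
  qed
  then show ?thesis by (rule set_integrable_subset) (use N' in auto)
qed

text \<open>
  The part of the truncated inner product that depends on \<open>t - s\<close> and not on \<open>N\<close>, normalised so that
  for \<open>a + b = 0\<close> the odd linear part is dropped; the factor \<open>\<bar>u\<bar>\<close> and the logarithm take the place of
  the power of \<open>\<bar>u\<bar>\<close> there.
\<close>

definition cov_profile :: "real \<Rightarrow> real \<Rightarrow> real \<Rightarrow> real" where
  "cov_profile a b u =
    (if a + b = 0 then a * u * ln \<bar>u\<bar> - Beta (a + 1) (b + 1) * cos (a * pi) / 2 * \<bar>u\<bar>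
     else Beta (a + 1) (b + 1) / sin ((a + b + 1) * pi) *
       (if u \<ge> 0 then sin (b * pi) else sin (a * pi)) * \<bar>u\<bar> powr (a + b + 1))"

text \<open>
  By translation and scaling the truncated integral is \<open>(t - s)\<^sup>h\<close> times the one with unit shift, taken
  at \<open>(N + s) / (t - s)\<close>. Re-expanding the powers of \<open>N + s\<close> around \<open>N\<close> turns the divergent part into
  one that is affine in \<open>(s, t)\<close>, symmetric under exchanging \<open>(a, s)\<close> with \<open>(b, t)\<close>.
\<close>

lemma trunc_inner_asymptotics_le:
  fixes a b s t :: real
  defines "h \<equiv> a + b + 1"
  assumes a: "-1 < a" and b: "-1 < b" "b < 1" and h: "0 < h" "h < 2" "h \<noteq> 1" and st: "s \<le> t"
  shows "((\<lambda>N. trunc_inner a b s t N - N powr h / h - (a * s + b * t) * N powr (h - 1) / (h - 1)) \<longlongrightarrow>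
    Beta (a + 1) (b + 1) / sin (h * pi) * sin (b * pi) * \<bar>t - s\<bar> powr h) at_top"
proof -
  have s2: "((\<lambda>N. N powr h * ((1 + s / N) powr h - 1 - h * (s / N))) \<longlongrightarrow> 0) at_top"
    by (rule powr_shift_second_order) (use h in auto)
  have s1: "((\<lambda>N. N powr (h - 1) * ((1 + s / N) powr (h - 1) - 1)) \<longlongrightarrow> 0) at_top"
    by (rule powr_shift_first_order) (use h in auto)
  have expand_diagonal: "N * P * (Q - 1 - h * (s / N)) / h = N * P * Q / h - N * P / h - s * k * P / k"
    if "N \<noteq> 0" "h \<noteq> 0" "k \<noteq> 0" for N P Q h s k :: real
    using that by (simp add: diff_divide_distrib right_diff_distrib)
  have expand_off_diagonal: "V * (T - N * P * Q1 / V / h - b * (u * P * Q2 / V) / k) + N * P * (Q1 - 1 - h * (s / N)) / h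
      + b * u / k * (P * (Q2 - 1)) = V * T - N * P / h - (s * k + b * u) * P / k"
    if "N \<noteq> 0" "h \<noteq> 0" "k \<noteq> 0" "V \<noteq> 0" for N P Q1 Q2 T V b h k s u :: real
    using that
    by (simp add: diff_divide_distrib right_diff_distrib add_divide_distrib distrib_right distrib_left mult_ac)
  have large: "\<forall>\<^sub>F N in at_top. N > 0 \<and> N + s > 0"
    using eventually_gt_at_top[of "max 0 (- s)"] by eventually_elim auto
  have p: "(N + s) powr c = N powr c * (1 + s / N) powr c" if "N > 0" "N + s > 0" for N c
  proof -
    have "N + s = N * (1 + s / N)" "1 + s / N > 0" using that by (auto simp: field_simps)
    then show ?thesis using that powr_mult[of N "1 + s / N" c] by simp
  qed
  show ?thesis
  proof (cases "s = t")
    case True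
    have "((\<lambda>N. N powr h * ((1 + s / N) powr h - 1 - h * (s / N)) / h) \<longlongrightarrow> 0 / h) at_top"
      by (intro tendsto_intros s2) (use h in auto)
    then have "((\<lambda>N. N powr h * ((1 + s / N) powr h - 1 - h * (s / N)) / h) \<longlongrightarrow>
        Beta (a + 1) (b + 1) / sin (h * pi) * sin (b * pi) * \<bar>t - s\<bar> powr h) at_top"
      using True by simp
    then show ?thesis
    proof (rule Lim_transform_eventually, intro eventually_mono[OF large])
      fix N assume N: "N > 0 \<and> N + s > 0"
      have "trunc_inner a b s t N = (N + s) powr h / h"
        using trunc_inner_diagonal(2)[of a b N s] N h True by (simp add: h_def)
      moreover have "N powr h = N * N powr (h - 1)" using N by (simp add: powr_diff)
      moreover have ab: "a * s + b * t = s * (h - 1)" using True by (simp add: h_def algebra_simps)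
      ultimately show "N powr h * ((1 + s / N) powr h - 1 - h * (s / N)) / h =
        trunc_inner a b s t N - N powr h / h - (a * s + b * t) * N powr (h - 1) / (h - 1)"
        unfolding ab using expand_diagonal[of N h "h - 1" "N powr (h - 1)" "(1 + s / N) powr h" s] N h p[of N h] by (simp add: mult.assoc)
    qed
  next
    case False
    define u where "u = t - s"
    have u: "u > 0" "t = s + u" using st False by (auto simp: u_def)
    have "filterlim (\<lambda>N. (N + s) / u) at_top at_top"
      using u by real_asymp
    from filterlim_compose[OF trunc_Beta_asymptotics[OF a b] this] h
    have lim: "((\<lambda>N. trunc_Beta a b ((N + s) / u) - ((N + s) / u) powr h / h - b * ((N + s) / u) powr (h - 1) / (h - 1)) \<longlongrightarrow>
       Beta (a + 1) (b + 1) * sin (b * pi) / sin (h * pi)) at_top"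
      by (simp add: h_def)
    have "((\<lambda>N. u powr h * (trunc_Beta a b ((N + s) / u) - ((N + s) / u) powr h / h - b * ((N + s) / u) powr (h - 1) / (h - 1))
        + N powr h * ((1 + s / N) powr h - 1 - h * (s / N)) / h
        + b * u / (h - 1) * (N powr (h - 1) * ((1 + s / N) powr (h - 1) - 1))) \<longlongrightarrow>
       u powr h * (Beta (a + 1) (b + 1) * sin (b * pi) / sin (h * pi)) + 0 / h + b * u / (h - 1) * 0) at_top"
      by (intro tendsto_intros lim s1 s2) (use h in auto)
    also have "u powr h * (Beta (a + 1) (b + 1) * sin (b * pi) / sin (h * pi)) + 0 / h + b * u / (h - 1) * 0 =
      Beta (a + 1) (b + 1) / sin (h * pi) * sin (b * pi) * \<bar>t - s\<bar> powr h"
      using st by (simp add: u_def)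
    finally show ?thesis
    proof (rule Lim_transform_eventually, intro eventually_mono[OF large])
      fix N assume N: "N > 0 \<and> N + s > 0"
      define Q1 Q2 P T where Q: "Q1 = (1 + s / N) powr h" "Q2 = (1 + s / N) powr (h - 1)"
        "P = N powr (h - 1)" "T = trunc_Beta a b ((N + s) / u)"
      have c: "trunc_inner a b s t N = u powr h * T"
        using trunc_inner_off_diagonal(2)[of a s t N b] N h st False a by (simp add: h_def u_def Q)
      have e3: "N powr h = N * P" using N by (simp add: powr_diff Q)
      have f1: "((N + s) / u) powr h = N * P * Q1 / u powr h"
        using N u p[of N h] by (simp add: powr_divide Q e3[unfolded Q])
      have f2: "((N + s) / u) powr (h - 1) = u * P * Q2 / u powr h"
      proof -
        have "((N + s) / u) powr (h - 1) = (N + s) powr (h - 1) / u powr (h - 1)"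
          using N u by (simp add: powr_divide)
        moreover have "u powr (h - 1) = u powr h / u" using u by (simp add: powr_diff)
        ultimately show ?thesis using N p[of N "h - 1"] by (simp add: Q)
      qed
      have h1: "h - 1 \<noteq> 0" "h \<noteq> 0" using h by auto
      have ab: "a * s + b * t = s * (h - 1) + b * u" using u by (simp add: h_def algebra_simps)
      have upos: "u powr h \<noteq> 0" using u by simp
      show "u powr h * (trunc_Beta a b ((N + s) / u) - ((N + s) / u) powr h / h - b * ((N + s) / u) powr (h - 1) / (h - 1))
        + N powr h * ((1 + s / N) powr h - 1 - h * (s / N)) / h
        + b * u / (h - 1) * (N powr (h - 1) * ((1 + s / N) powr (h - 1) - 1)) =
        trunc_inner a b s t N - N powr h / h - (a * s + b * t) * N powr (h - 1) / (h - 1)"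
        unfolding f1 f2 e3 ab c Q(1)[symmetric] Q(2)[symmetric] Q(3)[symmetric] Q(4)[symmetric]
        using h1 upos N by (intro expand_off_diagonal) auto
    qed
  qed
qed

text \<open>
  The constant term in the expansion of the truncated Beta integral with exponents \<open>a\<close> and \<open>-a\<close>.
\<close>

definition critical_const :: "real \<Rightarrow> real" where
  "critical_const a = - a + a * (Digamma (a + 1) + euler_mascheroni)"

text \<open>
  The sum is all that the covariance depends on: the difference of the two constants contributes to
  the truncated inner product only a term linear in \<open>t - s\<close>, which the alternating sum annihilates.
\<close>

lemma critical_const_sum:
  assumes "\<bar>a\<bar> < 1"
  shows "critical_const a + critical_const (- a) = 1 - Beta (1 + a) (1 - a) * cos (a * pi)"
  using Digamma_reflection_scaled[OF assms] by (simp add: critical_const_def algebra_simps)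

lemma trunc_inner_asymptotics_critical_le:
  fixes a s t :: real
  assumes a: "-1 < a" and st: "s \<le> t"
  shows "((\<lambda>N. trunc_inner a (- a) s t N - N + a * (t - s) * ln N) \<longlongrightarrow>
    s + (t - s) * critical_const a + a * (t - s) * ln \<bar>t - s\<bar>) at_top"
proof -
  have large: "\<forall>\<^sub>F N in at_top. N > 0 \<and> N + s > 0"
    using eventually_gt_at_top[of "max 0 (- s)"] by eventually_elim auto
  show ?thesis
  proof (cases "s = t")
    case True
    have "trunc_inner a (- a) s t N - N + a * (t - s) * ln N = s" if "N > 0 \<and> N + s > 0" for N
      using trunc_inner_diagonal(2)[of a "- a" N s] that True by simp
    then show ?thesis using True
      by (intro tendsto_eventually eventually_mono[OF large]) simp
  next
    case False
    define u where "u = t - s"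
    have u: "u > 0" using st False by (auto simp: u_def)
    have "filterlim (\<lambda>N. (N + s) / u) at_top at_top"
      using u by real_asymp
    from filterlim_compose[OF trunc_Beta_asymptotics_critical[OF a] this]
    have lim: "((\<lambda>N. trunc_Beta a (- a) ((N + s) / u) - (N + s) / u + a * ln ((N + s) / u)) \<longlongrightarrow> critical_const a) at_top"
      by (simp add: critical_const_def)
    have ln: "((\<lambda>N::real. ln (N + s) - ln N) \<longlongrightarrow> 0) at_top" by real_asymp
    have "((\<lambda>N. u * (trunc_Beta a (- a) ((N + s) / u) - (N + s) / u + a * ln ((N + s) / u)) + s + a * u * ln u
        - a * u * (ln (N + s) - ln N)) \<longlongrightarrow> u * critical_const a + s + a * u * ln u - a * u * 0) at_top"
      by (intro tendsto_intros lim ln)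
    also have "u * critical_const a + s + a * u * ln u - a * u * 0 = s + (t - s) * critical_const a + a * (t - s) * ln \<bar>t - s\<bar>"
      using st by (simp add: u_def)
    finally show ?thesis
    proof (rule Lim_transform_eventually, intro eventually_mono[OF large])
      fix N assume N: "N > 0 \<and> N + s > 0"
      have c: "trunc_inner a (- a) s t N = u * trunc_Beta a (- a) ((N + s) / u)"
        using trunc_inner_off_diagonal(2)[of a s t N "- a"] N st False a by (simp add: u_def)
      have l: "ln ((N + s) / u) = ln (N + s) - ln u" using N u by (simp add: ln_div)
      show "u * (trunc_Beta a (- a) ((N + s) / u) - (N + s) / u + a * ln ((N + s) / u)) + s + a * u * ln u
        - a * u * (ln (N + s) - ln N) = trunc_inner a (- a) s t N - N + a * (t - s) * ln N"
        unfolding c l u_def[symmetric] right_diff_distrib distrib_left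
        using u by (simp add: algebra_simps add_divide_distrib)
    qed
  qed
qed

lemma cov_profile_commute: "cov_profile a b u = cov_profile b a (- u)"
proof (cases "a + b = 0")
  case True
  then have "b = - a" by simp
  then show ?thesis by (simp add: cov_profile_def Beta_commute[of "a + 1"])
next
  case False
  then show ?thesis
    by (auto simp: cov_profile_def Beta_commute[of "a + 1"] add.commute[of b a] not_le)
qed

lemma cov_profile_0 [simp]: "cov_profile a b 0 = 0"
  by (simp add: cov_profile_def)

text \<open>
  The divergent part is affine in \<open>(s, t)\<close>, which is all that matters about it. The case \<open>s > t\<close> is the
  case \<open>s \<le> t\<close> with the two factors exchanged.
\<close>

lemma trunc_inner_asymptotics:
  fixes a b :: real
  assumes a: "\<bar>a\<bar> < 1 / 2" and b: "\<bar>b\<bar> < 1 / 2"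
  shows "\<exists>\<rho> \<rho>\<^sub>1 \<rho>\<^sub>2. \<forall>s t. ((\<lambda>N. trunc_inner a b s t N - (\<rho> N + s * \<rho>\<^sub>1 N + t * \<rho>\<^sub>2 N)) \<longlongrightarrow> cov_profile a b (t - s)) at_top"
proof (cases "a + b = 0")
  case False
  define h where "h = a + b + 1"
  have h: "0 < h" "h < 2" "h \<noteq> 1" using a b False by (auto simp: h_def)
  have "((\<lambda>N. trunc_inner a b s t N - N powr h / h - (a * s + b * t) * N powr (h - 1) / (h - 1)) \<longlongrightarrow> cov_profile a b (t - s)) at_top" for s t
  proof (cases "s \<le> t")
    case True
    then show ?thesis using trunc_inner_asymptotics_le[of a b s t] a b h False
      by (simp add: cov_profile_def h_def)
  next
    case False
    then show ?thesis using trunc_inner_asymptotics_le[of b a t s] a b h \<open>a + b \<noteq> 0\<close>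
      by (simp add: cov_profile_def h_def trunc_inner_commute[of a b] Beta_commute[of "1 + a"] add_ac abs_minus_commute)
  qed
  then show ?thesis
    by (rule_tac x = "\<lambda>N. N powr h / h" in exI, rule_tac x = "\<lambda>N. a * N powr (h - 1) / (h - 1)" in exI,
        rule_tac x = "\<lambda>N. b * N powr (h - 1) / (h - 1)" in exI)
       (simp add: diff_diff_eq add_divide_distrib distrib_left mult_ac add.assoc)
next
  case True
  then have b: "b = - a" by simp
  \<comment> \<open>Splitting the constants into even and odd part: the odd part \<open>\<delta>\<close> goes into the affine term,
    and so does \<open>min s t = (s + t - \<bar>t - s\<bar>) / 2\<close> up to its last summand.\<close>
  define \<delta> where "\<delta> = (critical_const a - critical_const (- a)) / 2"
  have c: "critical_const a = 1 / 2 - Beta (1 + a) (1 - a) * cos (a * pi) / 2 + \<delta>"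
      "critical_const (- a) = 1 / 2 - Beta (1 + a) (1 - a) * cos (a * pi) / 2 - \<delta>"
    using critical_const_sum[of a] a by (auto simp: \<delta>_def field_simps)
  have "((\<lambda>N. trunc_inner a b s t N - N + a * (t - s) * ln N - s * (1 / 2 - \<delta>) - t * (1 / 2 + \<delta>)) \<longlongrightarrow> cov_profile a b (t - s)) at_top" for s t
  proof (cases "s \<le> t")
    case True
    have "((\<lambda>N. trunc_inner a b s t N - N + a * (t - s) * ln N - s * (1 / 2 - \<delta>) - t * (1 / 2 + \<delta>)) \<longlongrightarrow>
      s + (t - s) * critical_const a + a * (t - s) * ln \<bar>t - s\<bar> - s * (1 / 2 - \<delta>) - t * (1 / 2 + \<delta>)) at_top"
      unfolding b using a True by (intro tendsto_intros trunc_inner_asymptotics_critical_le) auto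
    also have "s + (t - s) * critical_const a + a * (t - s) * ln \<bar>t - s\<bar> - s * (1 / 2 - \<delta>) - t * (1 / 2 + \<delta>) = cov_profile a b (t - s)"
      unfolding c using True b by (simp add: cov_profile_def add_ac) (simp add: field_simps)
    finally show ?thesis .
  next
    case False
    have "((\<lambda>N. trunc_inner b (- b) t s N - N + b * (s - t) * ln N - s * (1 / 2 - \<delta>) - t * (1 / 2 + \<delta>)) \<longlongrightarrow>
      t + (s - t) * critical_const b + b * (s - t) * ln \<bar>s - t\<bar> - s * (1 / 2 - \<delta>) - t * (1 / 2 + \<delta>)) at_top"
      using a b False by (intro tendsto_intros trunc_inner_asymptotics_critical_le) auto
    also have "t + (s - t) * critical_const b + b * (s - t) * ln \<bar>s - t\<bar> - s * (1 / 2 - \<delta>) - t * (1 / 2 + \<delta>) = cov_profile a b (t - s)"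
      unfolding b c using False by (simp add: cov_profile_def add_ac abs_minus_commute[of s t]) (simp add: field_simps)
    finally show ?thesis unfolding b by (simp add: trunc_inner_commute[of a] algebra_simps)
  qed
  then show ?thesis
    by (rule_tac x = "\<lambda>N. N" in exI, rule_tac x = "\<lambda>N. a * ln N + (1 / 2 - \<delta>)" in exI,
        rule_tac x = "\<lambda>N. - a * ln N + (1 / 2 + \<delta>)" in exI)
       (simp add: algebra_simps)
qed

text \<open>
  The backward kernel is \<open>shift_diff a (- t) x\<close> and the forward kernel is its reflection
  \<open>shift_diff a t (- x)\<close>, so that inner products within each direction reduce to this one function.
\<close>

definition shift_diff :: "real \<Rightarrow> real \<Rightarrow> real \<Rightarrow> real" where
  "shift_diff a t y = pos_part (y + t) powr a - pos_part y powr a"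

lemma shift_diff_measurable [measurable]: "shift_diff a t \<in> borel_measurable borel"
  unfolding shift_diff_def by measurable

text \<open>
  The product splits into four truncated inner products. In their alternating sum the divergent parts
  cancel, and \<open>E(0) = 0\<close>.
\<close>

lemma shift_diff_truncated_limit:
  fixes a b s t :: real
  assumes a: "\<bar>a\<bar> < 1 / 2" and b: "\<bar>b\<bar> < 1 / 2"
  shows "integrable lborel (\<lambda>y. shift_diff a s y * shift_diff b t y * indicator {..N} y)"
    and "((\<lambda>N. \<integral>y. shift_diff a s y * shift_diff b t y * indicator {..N} y \<partial>lborel) \<longlongrightarrow>
      cov_profile a b (t - s) - cov_profile a b (- s) - cov_profile a b t) at_top"
proof -
  have ab: "a > -1" "b > -1" "a + b > -1" using a b by auto
  let ?g = "\<lambda>s t y. pos_part (y + s) powr a * pos_part (y + t) powr b"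
  note i = trunc_inner_integrable[OF ab]
  have split: "(\<lambda>y. shift_diff a s y * shift_diff b t y) = (\<lambda>y. ?g s t y - ?g s 0 y - ?g 0 t y + ?g 0 0 y)"
    by (auto simp: shift_diff_def fun_eq_iff algebra_simps)
  have swap: "shift_diff a s y * shift_diff b t y * indicator {..N} y = indicator {..N} y *\<^sub>R (shift_diff a s y * shift_diff b t y)" for N y
    by simp
  show "integrable lborel (\<lambda>y. shift_diff a s y * shift_diff b t y * indicator {..N} y)" for N
    unfolding swap unfolding split set_integrable_def[symmetric] by (intro set_integral_add set_integral_diff i)
  have val: "(\<integral>y. shift_diff a s y * shift_diff b t y * indicator {..N} y \<partial>lborel) =
    trunc_inner a b s t N - trunc_inner a b s 0 N - trunc_inner a b 0 t N + trunc_inner a b 0 0 N" for N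
  proof -
    have "(\<integral>y. shift_diff a s y * shift_diff b t y * indicator {..N} y \<partial>lborel) = (LBINT y:{..N}. ?g s t y - ?g s 0 y - ?g 0 t y + ?g 0 0 y)"
      unfolding swap unfolding split set_lebesgue_integral_def[symmetric] ..
    also have "\<dots> = trunc_inner a b s t N - trunc_inner a b s 0 N - trunc_inner a b 0 t N + trunc_inner a b 0 0 N"
      unfolding trunc_inner_def by (simp add: set_integral_add set_integral_diff i del: add_0_right)
    finally show ?thesis .
  qed
  obtain \<rho> \<rho>1 \<rho>2 where lim: "((\<lambda>N. trunc_inner a b s t N - (\<rho> N + s * \<rho>1 N + t * \<rho>2 N)) \<longlongrightarrow> cov_profile a b (t - s)) at_top" for s t
    using trunc_inner_asymptotics[OF a b] by metis
  have "((\<lambda>N. (trunc_inner a b s t N - (\<rho> N + s * \<rho>1 N + t * \<rho>2 N)) - (trunc_inner a b s 0 N - (\<rho> N + s * \<rho>1 N + 0 * \<rho>2 N))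
     - (trunc_inner a b 0 t N - (\<rho> N + 0 * \<rho>1 N + t * \<rho>2 N)) + (trunc_inner a b 0 0 N - (\<rho> N + 0 * \<rho>1 N + 0 * \<rho>2 N))) \<longlongrightarrow>
     cov_profile a b (t - s) - cov_profile a b (0 - s) - cov_profile a b (t - 0) + cov_profile a b (0 - 0)) at_top"
    by (intro tendsto_intros lim)
  then show "((\<lambda>N. \<integral>y. shift_diff a s y * shift_diff b t y * indicator {..N} y \<partial>lborel) \<longlongrightarrow>
      cov_profile a b (t - s) - cov_profile a b (- s) - cov_profile a b t) at_top"
    unfolding val by (simp add: algebra_simps)
qed

text \<open>
  The truncated integrals of the square converge, so that monotone convergence gives integrability
  without an estimate of the decay at infinity.
\<close>

lemma shift_diff_square_integrable:
  assumes a: "\<bar>a\<bar> < 1 / 2"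
  shows "integrable lborel (\<lambda>y. (shift_diff a t y)\<^sup>2)"
  using integrable_monotone_convergence_at_top[OF _ _ _ shift_diff_truncated_limit[OF a a, of t t]]
  by (simp add: power2_eq_square)

lemma shift_diff_inner_product:
  fixes a b s t :: real
  assumes a: "\<bar>a\<bar> < 1 / 2" and b: "\<bar>b\<bar> < 1 / 2"
  shows "integrable lborel (\<lambda>y. shift_diff a s y * shift_diff b t y)"
    and "(\<integral>y. shift_diff a s y * shift_diff b t y \<partial>lborel) =
      cov_profile a b (t - s) - cov_profile a b (- s) - cov_profile a b t"
proof -
  show i: "integrable lborel (\<lambda>y. shift_diff a s y * shift_diff b t y)"
    by (intro integrable_mult_of_square_integrable shift_diff_square_integrable a b) auto
  show "(\<integral>y. shift_diff a s y * shift_diff b t y \<partial>lborel) =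
      cov_profile a b (t - s) - cov_profile a b (- s) - cov_profile a b t"
    using tendsto_integral_at_top[OF _ i] shift_diff_truncated_limit(2)[OF a b, of s t]
    by (intro tendsto_unique[OF trivial_limit_at_top_linorder]) (simp_all add: mult.commute)
qed

text \<open>
  The integrand lives on \<open>[t, s]\<close>, and the affine map onto \<open>[0, 1]\<close> turns it into the Beta integrand.
  For \<open>s \<le> t\<close> both sides are zero.
\<close>

lemma has_bochner_integral_Beta_kernel:
  fixes a b s t :: real assumes a: "a > -1" and b: "b > -1"
  shows "has_bochner_integral lborel (\<lambda>x. pos_part (s - x) powr a * pos_part (x - t) powr b)
    (Beta (a + 1) (b + 1) * pos_part (s - t) powr (a + b + 1))"
proof (cases "s \<le> t")
  case True
  then have eq: "(\<lambda>x. pos_part (s - x) powr a * pos_part (x - t) powr b) = (\<lambda>x. 0)"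
    by (auto simp: fun_eq_iff pos_part_def max_def)
  show ?thesis unfolding eq using True by (simp add: pos_part_def has_bochner_integral_zero)
next
  case False
  define u where "u = s - t"
  have u: "u > 0" using False by (simp add: u_def)
  have "has_bochner_integral lborel (\<lambda>z. indicator {0..1} z * (z powr b * (1 - z) powr a)) (Beta (b + 1) (a + 1))"
    using nonneg_has_integral_imp_set_integral[of "\<lambda>z. z powr b * (1 - z) powr a" "{0..1}" "Beta (b + 1) (a + 1)"]
      has_integral_Beta_real[of "b + 1" "a + 1"] a b
    by (simp add: has_bochner_integral_iff set_integrable_def set_lebesgue_integral_def)
  then have "has_bochner_integral lborel (\<lambda>z. u powr (a + b) * (indicator {0..1} z * (z powr b * (1 - z) powr a))) (u powr (a + b) * Beta (b + 1) (a + 1))"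
    by (rule has_bochner_integral_mult_right)
  also have "(\<lambda>z. u powr (a + b) * (indicator {0..1} z * (z powr b * (1 - z) powr a))) =
      (\<lambda>z. pos_part (s - (t + u * z)) powr a * pos_part (t + u * z - t) powr b)"
  proof
    fix z
    have e: "s - (t + u * z) = u * (1 - z)" by (simp add: u_def algebra_simps)
    show "u powr (a + b) * (indicator {0..1} z * (z powr b * (1 - z) powr a)) =
      pos_part (s - (t + u * z)) powr a * pos_part (t + u * z - t) powr b"
    proof (cases "0 \<le> z \<and> z \<le> 1")
      case True
      then have "pos_part (u * (1 - z)) = u * (1 - z)" "pos_part (u * z) = u * z"
        using u by (auto simp: pos_part_def)
      then show ?thesis unfolding e using True u by (simp add: powr_mult powr_add)
    next
      case False
      then have "pos_part (u * (1 - z)) = 0 \<or> pos_part (u * z) = 0"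
        using u by (auto simp: pos_part_def max_def mult_le_0_iff zero_le_mult_iff not_le)
      then show ?thesis unfolding e using False by auto
    qed
  qed
  finally have "has_bochner_integral lborel (\<lambda>z. pos_part (s - (t + u * z)) powr a * pos_part (t + u * z - t) powr b)
      ((u * u powr (a + b) * Beta (b + 1) (a + 1)) /\<^sub>R \<bar>u\<bar>)"
    using u by (simp add: field_simps)
  then have "has_bochner_integral lborel (\<lambda>x. pos_part (s - x) powr a * pos_part (x - t) powr b) (u * u powr (a + b) * Beta (b + 1) (a + 1))"
    using u by (subst lborel_has_bochner_integral_real_affine_iff[of u _ _ t]) auto
  moreover have "pos_part (s - t) = u" using u by (simp add: u_def pos_part_def)
  ultimately show ?thesis using u by (simp add: powr_add Beta_commute[of "b + 1"] mult_ac)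
qed

section \<open>The covariance of the process\<close>

definition plus_kernel :: "real \<Rightarrow> real \<Rightarrow> real \<Rightarrow> real" where
  "plus_kernel a t x = pos_part (t - x) powr a - pos_part (- x) powr a"

definition minus_kernel :: "real \<Rightarrow> real \<Rightarrow> real \<Rightarrow> real" where
  "minus_kernel a t x = neg_part (t - x) powr a - neg_part (- x) powr a"

lemma plus_kernel_eq: "plus_kernel a t x = shift_diff a t (- x)"
  by (simp add: plus_kernel_def shift_diff_def)

lemma minus_kernel_eq: "minus_kernel a t x = shift_diff a (- t) x"
  by (simp add: minus_kernel_def shift_diff_def pos_part_def neg_part_def)

lemma kernel_inner_products:
  fixes a b s t :: real
  assumes a: "\<bar>a\<bar> < 1 / 2" and b: "\<bar>b\<bar> < 1 / 2"
  shows "has_bochner_integral lborel (\<lambda>x. plus_kernel a s x * plus_kernel b t x)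
      (cov_profile a b (t - s) - cov_profile a b (- s) - cov_profile a b t)"
    and "has_bochner_integral lborel (\<lambda>x. minus_kernel a s x * minus_kernel b t x)
      (cov_profile a b (s - t) - cov_profile a b s - cov_profile a b (- t))"
    and "has_bochner_integral lborel (\<lambda>x. plus_kernel a s x * minus_kernel b t x)
      (Beta (a + 1) (b + 1) * (pos_part (s - t) powr (a + b + 1) - pos_part s powr (a + b + 1) - pos_part (- t) powr (a + b + 1)))"
proof -
  have D: "has_bochner_integral lborel (\<lambda>y. shift_diff a s y * shift_diff b t y)
      (cov_profile a b (t - s) - cov_profile a b (- s) - cov_profile a b t)" for s t
    using shift_diff_inner_product[OF a b] by (simp add: has_bochner_integral_iff)
  show "has_bochner_integral lborel (\<lambda>x. plus_kernel a s x * plus_kernel b t x)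
      (cov_profile a b (t - s) - cov_profile a b (- s) - cov_profile a b t)"
    using iffD1[OF lborel_has_bochner_integral_real_affine_iff[of "-1" _ _ 0] D[of s t]]
    by (simp add: plus_kernel_eq)
  show "has_bochner_integral lborel (\<lambda>x. minus_kernel a s x * minus_kernel b t x)
      (cov_profile a b (s - t) - cov_profile a b s - cov_profile a b (- t))"
    using D[of "- s" "- t"] by (simp add: minus_kernel_eq)
  let ?P = "\<lambda>s t x. pos_part (s - x) powr a * pos_part (x - t) powr b"
  have "has_bochner_integral lborel (\<lambda>x. ?P s t x - ?P s 0 x - ?P 0 t x + ?P 0 0 x)
     (Beta (a + 1) (b + 1) * pos_part (s - t) powr (a + b + 1) - Beta (a + 1) (b + 1) * pos_part (s - 0) powr (a + b + 1)
     - Beta (a + 1) (b + 1) * pos_part (0 - t) powr (a + b + 1) + Beta (a + 1) (b + 1) * pos_part (0 - 0) powr (a + b + 1))"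
    using a b by (intro has_bochner_integral_add has_bochner_integral_diff has_bochner_integral_Beta_kernel) auto
  also have "(\<lambda>x. ?P s t x - ?P s 0 x - ?P 0 t x + ?P 0 0 x) = (\<lambda>x. plus_kernel a s x * minus_kernel b t x)"
    by (simp add: fun_eq_iff plus_kernel_def minus_kernel_eq shift_diff_def algebra_simps)
  finally show "has_bochner_integral lborel (\<lambda>x. plus_kernel a s x * minus_kernel b t x)
      (Beta (a + 1) (b + 1) * (pos_part (s - t) powr (a + b + 1) - pos_part s powr (a + b + 1) - pos_part (- t) powr (a + b + 1)))"
    by (simp add: pos_part_def[of 0] algebra_simps)
qed

lemma mfbm_kernel_component:
  "mfbm_kernel H Ap Am t x $ i $ k =
    Ap $ i $ k * plus_kernel (H $ i - 1 / 2) t x + Am $ i $ k * minus_kernel (H $ i - 1 / 2) t x"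
proof -
  have "((diag_power u H - diag_power v H) ** A) $ i $ k = A $ i $ k * (u powr (H $ i - 1 / 2) - v powr (H $ i - 1 / 2))"
    for u v and A :: "real ^ 'a ^ 'a"
  proof -
    have c: "(diag_power u H - diag_power v H) $ i $ l * A $ l $ k =
        (if i = l then A $ i $ k * (u powr (H $ i - 1 / 2) - v powr (H $ i - 1 / 2)) else 0)" for l
      by (auto simp: diag_power_def)
    show ?thesis unfolding matrix_matrix_mult_def vec_lambda_beta c by simp
  qed
  then show ?thesis by (simp add: mfbm_kernel_def plus_kernel_def minus_kernel_def)
qed

text \<open>
  The isometry, the bilinearity of the inner product, and the three inner products of scalar kernels;
  the fourth one, backward with forward, is the mixed one with the indices and times exchanged.
\<close>

lemma mfbm_covariance:
  fixes H :: "real ^ 'p::finite"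
  assumes H: "\<And>i. 0 < H $ i \<and> H $ i < 1" and W: "gaussian_white_noise M W"
    and X: "\<And>t. has_wiener_integral_matrix M W (mfbm_kernel H Ap Am t) (X t)"
  defines "a \<equiv> \<lambda>i. H $ i - 1 / 2"
  shows "(\<integral>\<omega>. X s \<omega> $ i * X t \<omega> $ j \<partial>M) =
      \<alpha> Ap Ap i j * (cov_profile (a i) (a j) (t - s) - cov_profile (a i) (a j) (- s) - cov_profile (a i) (a j) t)
    + \<alpha> Am Am i j * (cov_profile (a i) (a j) (s - t) - cov_profile (a i) (a j) s - cov_profile (a i) (a j) (- t))
    + Beta (H $ i + 1 / 2) (H $ j + 1 / 2) *
      (\<alpha> Ap Am i j * (pos_part (s - t) powr (H $ i + H $ j) - pos_part s powr (H $ i + H $ j) - pos_part (- t) powr (H $ i + H $ j))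
     + \<alpha> Am Ap i j * (pos_part (t - s) powr (H $ i + H $ j) - pos_part t powr (H $ i + H $ j) - pos_part (- s) powr (H $ i + H $ j)))"
proof -
  have ai: "\<bar>a i\<bar> < 1 / 2" for i using H[of i] by (auto simp: a_def abs_if)
  have e: "a i + 1 = H $ i + 1 / 2" "a i + a j + 1 = H $ i + H $ j" for i j by (auto simp: a_def)
  let ?P = "plus_kernel" and ?M = "minus_kernel"
  let ?Ipp = "cov_profile (a i) (a j) (t - s) - cov_profile (a i) (a j) (- s) - cov_profile (a i) (a j) t"
  let ?Imm = "cov_profile (a i) (a j) (s - t) - cov_profile (a i) (a j) s - cov_profile (a i) (a j) (- t)"
  let ?B = "Beta (H $ i + 1 / 2) (H $ j + 1 / 2)" and ?h = "H $ i + H $ j"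
  let ?Ipm = "?B * (pos_part (s - t) powr ?h - pos_part s powr ?h - pos_part (- t) powr ?h)"
  let ?Imp = "?B * (pos_part (t - s) powr ?h - pos_part t powr ?h - pos_part (- s) powr ?h)"
  note k = kernel_inner_products[OF ai ai]
  have mp: "has_bochner_integral lborel (\<lambda>x. ?M (a i) s x * ?P (a j) t x) ?Imp"
    using k(3)[of j t i s] unfolding e by (simp add: mult.commute Beta_commute[of "H $ j + 1 / 2"] add.commute)
  have int: "(\<integral>x. mfbm_kernel H Ap Am s x $ i $ k * mfbm_kernel H Ap Am t x $ j $ k \<partial>lborel) =
      Ap $ i $ k * Ap $ j $ k * ?Ipp + Am $ i $ k * Am $ j $ k * ?Imm + Ap $ i $ k * Am $ j $ k * ?Ipm + Am $ i $ k * Ap $ j $ k * ?Imp" for k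
  proof (rule has_bochner_integral_integral_eq)
    have "has_bochner_integral lborel (\<lambda>x. Ap $ i $ k * Ap $ j $ k * (?P (a i) s x * ?P (a j) t x)
        + Am $ i $ k * Am $ j $ k * (?M (a i) s x * ?M (a j) t x)
        + Ap $ i $ k * Am $ j $ k * (?P (a i) s x * ?M (a j) t x)
        + Am $ i $ k * Ap $ j $ k * (?M (a i) s x * ?P (a j) t x))
      (Ap $ i $ k * Ap $ j $ k * ?Ipp + Am $ i $ k * Am $ j $ k * ?Imm + Ap $ i $ k * Am $ j $ k * ?Ipm + Am $ i $ k * Ap $ j $ k * ?Imp)"
      by (intro has_bochner_integral_add has_bochner_integral_mult_right k(1,2) k(3)[of i s j t, unfolded e] mp)
    also have "(\<lambda>x. Ap $ i $ k * Ap $ j $ k * (?P (a i) s x * ?P (a j) t x)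
        + Am $ i $ k * Am $ j $ k * (?M (a i) s x * ?M (a j) t x)
        + Ap $ i $ k * Am $ j $ k * (?P (a i) s x * ?M (a j) t x)
        + Am $ i $ k * Ap $ j $ k * (?M (a i) s x * ?P (a j) t x)) =
      (\<lambda>x. mfbm_kernel H Ap Am s x $ i $ k * mfbm_kernel H Ap Am t x $ j $ k)"
      unfolding mfbm_kernel_component by (simp add: a_def fun_eq_iff algebra_simps)
    finally show "has_bochner_integral lborel (\<lambda>x. mfbm_kernel H Ap Am s x $ i $ k * mfbm_kernel H Ap Am t x $ j $ k)
      (Ap $ i $ k * Ap $ j $ k * ?Ipp + Am $ i $ k * Am $ j $ k * ?Imm + Ap $ i $ k * Am $ j $ k * ?Ipm + Am $ i $ k * Ap $ j $ k * ?Imp)" .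
  qed
  have "(\<integral>\<omega>. X s \<omega> $ i * X t \<omega> $ j \<partial>M) = \<alpha> Ap Ap i j * ?Ipp + \<alpha> Am Am i j * ?Imm + \<alpha> Ap Am i j * ?Ipm + \<alpha> Am Ap i j * ?Imp"
    unfolding vector_wiener_integral_covariance(1)[OF W X X] int \<alpha>_def by (simp add: sum.distrib sum_distrib_right)
  then show ?thesis by (simp add: algebra_simps)
qed

lemma alpha_commute: "\<alpha> A B i j = \<alpha> B A j i"
  by (simp add: \<alpha>_def mult.commute)

text \<open>
  The product \<open>\<sigma>\<^sub>i \<sigma>\<^sub>j c\<^sub>i\<^sub>j / 2\<close>.
\<close>

definition cov_coeff :: "real ^ 'p \<Rightarrow> real ^ 'p ^ 'p \<Rightarrow> real ^ 'p ^ 'p \<Rightarrow> 'p \<Rightarrow> 'p::finite \<Rightarrow> real" where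
  "cov_coeff H Ap Am i j = Beta (H $ i + 1 / 2) (H $ j + 1 / 2) / sin ((H $ i + H $ j) * pi) *
    (\<alpha> Ap Ap i j * cos (H $ i * pi) + \<alpha> Am Am i j * cos (H $ j * pi) - \<alpha> Ap Am i j * sin ((H $ i + H $ j) * pi))"

lemma sin_minus_half_pi: "sin ((x - 1 / 2) * pi) = - cos (x * pi)"
  by (simp add: left_diff_distrib sin_diff)

lemma cos_minus_half_pi: "cos ((x - 1 / 2) * pi) = sin (x * pi)"
  by (simp add: left_diff_distrib cos_diff)

text \<open>
  The covariance is an alternating sum in which every summand depends on one of \<open>s\<close>, \<open>t\<close>, \<open>t - s\<close>.
  Hence it is enough to compare the formulas for a single time \<open>u\<close>, according to its sign.
\<close>

lemma cov_coeff_split: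
  fixes H :: "real ^ 'p::finite"
  assumes H: "\<And>i. 0 < H $ i \<and> H $ i < 1" and h: "H $ i + H $ j \<noteq> 1"
  defines "a \<equiv> \<lambda>i. H $ i - 1 / 2"
  shows "sign_select (cov_coeff H Ap Am) i j u * \<bar>u\<bar> powr (H $ i + H $ j) =
    - \<alpha> Ap Ap i j * cov_profile (a i) (a j) (- u) - \<alpha> Am Am i j * cov_profile (a i) (a j) u
    - Beta (H $ i + 1 / 2) (H $ j + 1 / 2) * (\<alpha> Ap Am i j * pos_part u powr (H $ i + H $ j) + \<alpha> Am Ap i j * pos_part (- u) powr (H $ i + H $ j))"
proof -
  have e: "a i + 1 = H $ i + 1 / 2" "a j + 1 = H $ j + 1 / 2" "a i + a j + 1 = H $ i + H $ j" "a i + a j \<noteq> 0"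
    using h by (auto simp: a_def)
  have trig: "sin (a i * pi) = - cos (H $ i * pi)" "sin (a j * pi) = - cos (H $ j * pi)"
    unfolding a_def by (rule sin_minus_half_pi)+
  define S where "S = sin ((H $ i + H $ j) * pi)"
  have S: "S \<noteq> 0" unfolding S_def using H[of i] H[of j] h by (intro sin_mult_pi_nonzero) auto
  have S': "sin ((H $ j + H $ i) * pi) = S" by (simp add: S_def add.commute)
  define B where "B = Beta (H $ i + 1 / 2) (H $ j + 1 / 2)"
  have B': "Beta (H $ j + 1 / 2) (H $ i + 1 / 2) = B" by (simp add: B_def Beta_commute)
  have k: "cov_profile (a i) (a j) v = B / S * (if v \<ge> 0 then - cos (H $ j * pi) else - cos (H $ i * pi)) * \<bar>v\<bar> powr (H $ i + H $ j)" for v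
    using e(4) by (simp add: cov_profile_def e(1-3) trig B_def S_def)
  note c = cov_coeff_def[of H Ap Am i j] cov_coeff_def[of H Ap Am j i]
    alpha_commute[of Ap Ap j i] alpha_commute[of Am Am j i] alpha_commute[of Ap Am j i]
  consider "u > 0" | "u = 0" | "u < 0" by linarith
  then show ?thesis
  proof cases
    case 1
    then show ?thesis unfolding k sign_select_def c B' S' B_def[symmetric] S_def[symmetric] using S
      by (simp add: pos_part_def) (simp add: field_simps)
  next
    case 3
    then show ?thesis unfolding k sign_select_def c B' S' B_def[symmetric] S_def[symmetric] using S
      by (simp add: pos_part_def) (simp add: field_simps)
  qed (simp add: pos_part_def)
qed

lemma mfbm_covariance_noncritical:
  fixes H :: "real ^ 'p::finite"
  assumes H: "\<And>i. 0 < H $ i \<and> H $ i < 1" and W: "gaussian_white_noise M W"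
    and X: "\<And>t. has_wiener_integral_matrix M W (mfbm_kernel H Ap Am t) (X t)"
    and h: "H $ i + H $ j \<noteq> 1"
  shows "(\<integral>\<omega>. X s \<omega> $ i * X t \<omega> $ j \<partial>M) =
    sign_select (cov_coeff H Ap Am) i j s * \<bar>s\<bar> powr (H $ i + H $ j)
    + sign_select (cov_coeff H Ap Am) j i t * \<bar>t\<bar> powr (H $ i + H $ j)
    - sign_select (cov_coeff H Ap Am) j i (t - s) * \<bar>t - s\<bar> powr (H $ i + H $ j)"
proof -
  note split_ij = cov_coeff_split[OF H h, of Ap Am]
  have split_ji: "sign_select (cov_coeff H Ap Am) j i u * \<bar>u\<bar> powr (H $ i + H $ j) =
    - \<alpha> Ap Ap i j * cov_profile (H $ i - 1 / 2) (H $ j - 1 / 2) u - \<alpha> Am Am i j * cov_profile (H $ i - 1 / 2) (H $ j - 1 / 2) (- u)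
    - Beta (H $ i + 1 / 2) (H $ j + 1 / 2) * (\<alpha> Am Ap i j * pos_part u powr (H $ i + H $ j) + \<alpha> Ap Am i j * pos_part (- u) powr (H $ i + H $ j))" for u
  proof -
    have h': "H $ j + H $ i \<noteq> 1" using h by (simp add: add.commute)
    have "cov_profile (H $ j - 1 / 2) (H $ i - 1 / 2) v = cov_profile (H $ i - 1 / 2) (H $ j - 1 / 2) (- v)" for v
      by (rule cov_profile_commute)
    with cov_coeff_split[OF H h', of Ap Am u] show ?thesis
      by (simp add: alpha_commute[of Ap Ap j i] alpha_commute[of Am Am j i] alpha_commute[of Ap Am j i] alpha_commute[of Am Ap j i]
          Beta_commute[of "H $ j + 1 / 2"] add.commute[of "H $ j" "H $ i"])
  qed
  have "- (t - s) = s - t" by simp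
  then show ?thesis
    unfolding mfbm_covariance[OF H W X] split_ij split_ji by (simp add: algebra_simps)
qed

text \<open>
  The product \<open>\<sigma>\<^sub>i \<sigma>\<^sub>j d\<^sub>i\<^sub>j\<close>.
\<close>

definition critical_coeff :: "real ^ 'p \<Rightarrow> real ^ 'p ^ 'p \<Rightarrow> real ^ 'p ^ 'p \<Rightarrow> 'p \<Rightarrow> 'p::finite \<Rightarrow> real" where
  "critical_coeff H Ap Am i j = Beta (H $ i + 1 / 2) (H $ j + 1 / 2) *
    ((sin (H $ i * pi) + sin (H $ j * pi)) / 2 * (\<alpha> Ap Ap i j + \<alpha> Am Am i j) - \<alpha> Ap Am i j - \<alpha> Am Ap i j)"

text \<open>
  Since \<open>H\<^sub>i\<close> and \<open>H\<^sub>j\<close> add up to \<open>1\<close>, their sines agree and \<open>u\<^sub>+ = (\<bar>u\<bar> + u) / 2\<close> takes the place of the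
  power. The odd parts cancel in the alternating sums. Reflecting time changes the sign of the
  logarithmic part, which is why \<open>\<alpha>\<^sup>+\<^sup>+ - \<alpha>\<^sup>-\<^sup>-\<close> appears.
\<close>

lemma mfbm_covariance_critical:
  fixes H :: "real ^ 'p::finite"
  assumes H: "\<And>i. 0 < H $ i \<and> H $ i < 1" and W: "gaussian_white_noise M W"
    and X: "\<And>t. has_wiener_integral_matrix M W (mfbm_kernel H Ap Am t) (X t)"
    and h: "H $ i + H $ j = 1"
  shows "(\<integral>\<omega>. X s \<omega> $ i * X t \<omega> $ j \<partial>M) =
    (critical_coeff H Ap Am i j * (\<bar>s\<bar> + \<bar>t\<bar> - \<bar>s - t\<bar>)
    + (H $ j - H $ i) * (\<alpha> Ap Ap i j - \<alpha> Am Am i j) * (t * ln \<bar>t\<bar> - s * ln \<bar>s\<bar> - (t - s) * ln \<bar>t - s\<bar>)) / 2"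
proof -
  define a where "a = H $ i - 1 / 2"
  define B where "B = Beta (H $ i + 1 / 2) (H $ j + 1 / 2)"
  define c where "c = sin (H $ i * pi)"
  have sj: "sin (H $ j * pi) = c"
  proof -
    have "H $ j * pi = pi - H $ i * pi" using h by (metis add_diff_cancel_left' left_diff_distrib mult_1)
    then show ?thesis by (simp add: c_def)
  qed
  have aj: "H $ j - 1 / 2 = - a" "H $ j - H $ i = - 2 * a" using h by (auto simp: a_def)
  have k: "cov_profile a (- a) u = a * (u * ln \<bar>u\<bar>) - B * c / 2 * \<bar>u\<bar>" for u
  proof -
    have "a + 1 = H $ i + 1 / 2" "- a + 1 = H $ j + 1 / 2" using h by (auto simp: a_def)
    moreover have "cos (a * pi) = c" unfolding a_def c_def by (rule cos_minus_half_pi)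
    ultimately show ?thesis by (simp only: cov_profile_def B_def) simp
  qed
  have p: "pos_part u powr (H $ i + H $ j) = (\<bar>u\<bar> + u) / 2" for u
    unfolding h by (auto simp: pos_part_def max_def)
  define L where "L u = u * ln \<bar>u\<bar>" for u :: real
  have L: "L (- u) = - L u" for u by (simp add: L_def)
  have Ld: "L (s - t) = - L (t - s)" using L[of "t - s"] by simp
  show ?thesis
    unfolding mfbm_covariance[OF H W X] critical_coeff_def sj a_def[symmetric] aj k p B_def[symmetric] c_def[symmetric]
    unfolding L_def[symmetric]
    unfolding L Ld abs_minus_commute[of t s] abs_minus_cancel
    by (simp add: field_simps)
qed

theorem proposition3p1:
  fixes M :: "'a measure"
    and W :: "real set \<Rightarrow> 'a \<Rightarrow> real ^ 'p::finite"
    and H :: "real ^ 'p"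
    and Ap Am :: "real ^ 'p ^ 'p"
    and X :: "real \<Rightarrow> 'a \<Rightarrow> real ^ 'p"
    and \<sigma> :: "'p \<Rightarrow> real"
  assumes H: "\<And>i. 0 < H $ i \<and> H $ i < 1"
    and W: "gaussian_white_noise M W"
    and X: "\<And>t. has_wiener_integral_matrix M W (mfbm_kernel H Ap Am t) (X t)"
    and \<sigma>: "\<And>i. \<sigma> i \<ge> 0"
      "\<And>i. (\<sigma> i)\<^sup>2 = prob_space.variance M (\<lambda>\<omega>. X 1 \<omega> $ i)"
  shows
    "(\<forall>i. (\<sigma> i)\<^sup>2 =
        Beta (H $ i + 1 / 2) (H $ i + 1 / 2) / sin (H $ i * pi) *
        (\<alpha> Ap Ap i i + \<alpha> Am Am i i - 2 * sin (H $ i * pi) * \<alpha> Ap Am i i))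
     \<and>
     (\<exists>c. \<forall>i j. H $ i + H $ j \<noteq> 1 \<longrightarrow>
        \<sigma> i * \<sigma> j / 2 * c i j =
          Beta (H $ i + 1 / 2) (H $ j + 1 / 2) / sin ((H $ i + H $ j) * pi) *
          (\<alpha> Ap Ap i j * cos (H $ i * pi) + \<alpha> Am Am i j * cos (H $ j * pi)
            - \<alpha> Ap Am i j * sin ((H $ i + H $ j) * pi)) \<and>
        (\<forall>s t. prob_space.expectation M (\<lambda>\<omega>. X s \<omega> $ i * X t \<omega> $ j) =
          \<sigma> i * \<sigma> j / 2 *
          (sign_select c i j s * \<bar>s\<bar> powr (H $ i + H $ j)
            + sign_select c j i t * \<bar>t\<bar> powr (H $ i + H $ j)
            - sign_select c j i (t - s) * \<bar>t - s\<bar> powr (H $ i + H $ j))))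
     \<and>
     (\<exists>d f. \<forall>i j. H $ i + H $ j = 1 \<longrightarrow>
        \<sigma> i * \<sigma> j * d i j =
          Beta (H $ i + 1 / 2) (H $ j + 1 / 2) *
          ((sin (H $ i * pi) + sin (H $ j * pi)) / 2 * (\<alpha> Ap Ap i j + \<alpha> Am Am i j)
            - \<alpha> Ap Am i j - \<alpha> Am Ap i j) \<and>
        \<sigma> i * \<sigma> j * f i j = (H $ j - H $ i) * (\<alpha> Ap Ap i j - \<alpha> Am Am i j) \<and>
        (\<forall>s t. prob_space.expectation M (\<lambda>\<omega>. X s \<omega> $ i * X t \<omega> $ j) =
          \<sigma> i * \<sigma> j / 2 *
          (d i j * (\<bar>s\<bar> + \<bar>t\<bar> - \<bar>s - t\<bar>)
            + f i j * (t * ln \<bar>t\<bar> - s * ln \<bar>s\<bar> - (t - s) * ln \<bar>t - s\<bar>))))"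
proof (intro conjI)
  let ?K = "cov_coeff H Ap Am" and ?D = "critical_coeff H Ap Am"
  define C where "C i j s t = (\<integral>\<omega>. X s \<omega> $ i * X t \<omega> $ j \<partial>M)" for i j s t
  define F where "F i j = (H $ j - H $ i) * (\<alpha> Ap Ap i j - \<alpha> Am Am i j)" for i j
  note noncrit = mfbm_covariance_noncritical[OF H W X, folded C_def]
  note crit = mfbm_covariance_critical[OF H W X, folded C_def F_def]
  have var: "(\<sigma> i)\<^sup>2 = C i i 1 1" for i
    unfolding C_def \<sigma>(2) vector_wiener_integral_covariance(2)[OF W X X[of 0]]
    by (simp add: power2_eq_square)

  have sigma_noncrit: "(\<sigma> i)\<^sup>2 = 2 * ?K i i" if "H $ i + H $ i \<noteq> 1" for i
    unfolding var noncrit[OF that] by (simp add: sign_select_def)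
  have sigma_crit: "(\<sigma> i)\<^sup>2 = ?D i i" if "H $ i + H $ i = 1" for i
    unfolding var crit[OF that] by simp

  \<comment> \<open>Self-similarity: the second moment at time \<open>s\<close> is a multiple of the one at time \<open>1\<close>.\<close>
  have second_moment: "C i i s s = 0" if "\<sigma> i = 0" for i s
  proof (cases "H $ i + H $ i = 1")
    case True
    then show ?thesis using crit[OF True, of s s] sigma_crit[OF True] that by simp
  next
    case False
    then show ?thesis using noncrit[OF False, of s s] sigma_noncrit[OF False] that
      by (simp add: sign_select_def)
  qed
  have degenerate: "C i j s t = 0" if "\<sigma> i * \<sigma> j = 0" for i j s t
  proof -
    have "\<bar>C i j s t\<bar> \<le> sqrt (C i i s s) * sqrt (C j j t t)"
      unfolding C_def power2_eq_square[symmetric]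
      by (intro Cauchy_Schwarz_integral vector_wiener_integral_covariance(3,4)[OF W X X[of 0]])
    moreover have "C i i s s = 0 \<or> C j j t t = 0" using that second_moment by auto
    ultimately show ?thesis by auto
  qed

  show "\<forall>i. (\<sigma> i)\<^sup>2 =
        Beta (H $ i + 1 / 2) (H $ i + 1 / 2) / sin (H $ i * pi) *
        (\<alpha> Ap Ap i i + \<alpha> Am Am i i - 2 * sin (H $ i * pi) * \<alpha> Ap Am i i)"
  proof
    fix i
    have am: "\<alpha> Am Ap i i = \<alpha> Ap Am i i" by (rule alpha_commute)
    show "(\<sigma> i)\<^sup>2 =
        Beta (H $ i + 1 / 2) (H $ i + 1 / 2) / sin (H $ i * pi) *
        (\<alpha> Ap Ap i i + \<alpha> Am Am i i - 2 * sin (H $ i * pi) * \<alpha> Ap Am i i)"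
    proof (cases "H $ i + H $ i = 1")
      case True
      then have half: "H $ i = 1 / 2" by linarith
      have "sin (H $ i * pi) = 1" unfolding half by simp
      then show ?thesis unfolding sigma_crit[OF True] critical_coeff_def am by simp
    next
      case False
      have d: "sin ((H $ i + H $ i) * pi) = 2 * sin (H $ i * pi) * cos (H $ i * pi)"
      proof -
        have "(H $ i + H $ i) * pi = 2 * (H $ i * pi)" by simp
        then show ?thesis by (simp only: sin_double)
      qed
      have "sin ((H $ i + H $ i) * pi) \<noteq> 0"
        using H[of i] False by (intro sin_mult_pi_nonzero) auto
      then show ?thesis unfolding sigma_noncrit[OF False] cov_coeff_def d by (simp add: field_simps)
    qed
  qed

  show "\<exists>c. \<forall>i j. H $ i + H $ j \<noteq> 1 \<longrightarrow>
        \<sigma> i * \<sigma> j / 2 * c i j =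
          Beta (H $ i + 1 / 2) (H $ j + 1 / 2) / sin ((H $ i + H $ j) * pi) *
          (\<alpha> Ap Ap i j * cos (H $ i * pi) + \<alpha> Am Am i j * cos (H $ j * pi)
            - \<alpha> Ap Am i j * sin ((H $ i + H $ j) * pi)) \<and>
        (\<forall>s t. prob_space.expectation M (\<lambda>\<omega>. X s \<omega> $ i * X t \<omega> $ j) =
          \<sigma> i * \<sigma> j / 2 *
          (sign_select c i j s * \<bar>s\<bar> powr (H $ i + H $ j)
            + sign_select c j i t * \<bar>t\<bar> powr (H $ i + H $ j)
            - sign_select c j i (t - s) * \<bar>t - s\<bar> powr (H $ i + H $ j)))"
  proof (intro exI allI impI)
    fix i j assume h: "H $ i + H $ j \<noteq> 1"
    let ?c = "\<lambda>i j. 2 * ?K i j / (\<sigma> i * \<sigma> j)"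
    \<comment> \<open>At \<open>(1, 1)\<close> the formula gives \<open>K\<^sub>i\<^sub>j + K\<^sub>j\<^sub>i\<close>; at \<open>(1, -1)\<close> only \<open>K\<^sub>i\<^sub>j\<close> occurs, with the factor \<open>2 - 2\<^sup>h\<close>.\<close>
    have K0: "?K i j = 0 \<and> ?K j i = 0" if s0: "\<sigma> i * \<sigma> j = 0"
    proof -
      have K: "?K i j + ?K j i = 0"
        using noncrit[OF h, of 1 1] degenerate[OF s0] by (simp add: sign_select_def)
      have "(2 - 2 powr (H $ i + H $ j)) * ?K i j = 0"
        using noncrit[OF h, of 1 "-1"] degenerate[OF s0] by (simp add: sign_select_def algebra_simps)
      moreover have "2 powr (H $ i + H $ j) \<noteq> 2 powr 1" using h by (subst powr_inj) auto
      ultimately have "?K i j = 0" by auto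
      with K show ?thesis by simp
    qed
    have c: "\<sigma> i * \<sigma> j / 2 * ?c i j = ?K i j" "\<sigma> i * \<sigma> j / 2 * ?c j i = ?K j i"
      using K0 by auto
    have sel: "\<sigma> i * \<sigma> j / 2 * sign_select ?c i j u = sign_select ?K i j u"
      "\<sigma> i * \<sigma> j / 2 * sign_select ?c j i u = sign_select ?K j i u" for u
      by (cases "u > 0"; simp only: sign_select_def if_True if_False c)+
    have "C i j s t = \<sigma> i * \<sigma> j / 2 *
          (sign_select ?c i j s * \<bar>s\<bar> powr (H $ i + H $ j)
            + sign_select ?c j i t * \<bar>t\<bar> powr (H $ i + H $ j)
            - sign_select ?c j i (t - s) * \<bar>t - s\<bar> powr (H $ i + H $ j))" for s t
      unfolding noncrit[OF h] sel[symmetric] by (simp only: distrib_left right_diff_distrib mult.assoc)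
    then show "\<sigma> i * \<sigma> j / 2 * ?c i j =
          Beta (H $ i + 1 / 2) (H $ j + 1 / 2) / sin ((H $ i + H $ j) * pi) *
          (\<alpha> Ap Ap i j * cos (H $ i * pi) + \<alpha> Am Am i j * cos (H $ j * pi)
            - \<alpha> Ap Am i j * sin ((H $ i + H $ j) * pi)) \<and>
        (\<forall>s t. prob_space.expectation M (\<lambda>\<omega>. X s \<omega> $ i * X t \<omega> $ j) =
          \<sigma> i * \<sigma> j / 2 *
          (sign_select ?c i j s * \<bar>s\<bar> powr (H $ i + H $ j)
            + sign_select ?c j i t * \<bar>t\<bar> powr (H $ i + H $ j)
            - sign_select ?c j i (t - s) * \<bar>t - s\<bar> powr (H $ i + H $ j)))"
      unfolding c(1) C_def[symmetric] by (simp only: cov_coeff_def) blast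
  qed

  show "\<exists>d f. \<forall>i j. H $ i + H $ j = 1 \<longrightarrow>
        \<sigma> i * \<sigma> j * d i j =
          Beta (H $ i + 1 / 2) (H $ j + 1 / 2) *
          ((sin (H $ i * pi) + sin (H $ j * pi)) / 2 * (\<alpha> Ap Ap i j + \<alpha> Am Am i j)
            - \<alpha> Ap Am i j - \<alpha> Am Ap i j) \<and>
        \<sigma> i * \<sigma> j * f i j = (H $ j - H $ i) * (\<alpha> Ap Ap i j - \<alpha> Am Am i j) \<and>
        (\<forall>s t. prob_space.expectation M (\<lambda>\<omega>. X s \<omega> $ i * X t \<omega> $ j) =
          \<sigma> i * \<sigma> j / 2 *
          (d i j * (\<bar>s\<bar> + \<bar>t\<bar> - \<bar>s - t\<bar>)
            + f i j * (t * ln \<bar>t\<bar> - s * ln \<bar>s\<bar> - (t - s) * ln \<bar>t - s\<bar>)))"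
  proof (intro exI allI impI)
    fix i j assume h: "H $ i + H $ j = 1"
    let ?d = "\<lambda>i j. ?D i j / (\<sigma> i * \<sigma> j)" and ?f = "\<lambda>i j. F i j / (\<sigma> i * \<sigma> j)"
    \<comment> \<open>At \<open>(1, 1)\<close> the logarithms vanish; at \<open>(1, 2)\<close> the logarithmic part equals \<open>2 log 2\<close>.\<close>
    have DF0: "?D i j = 0 \<and> F i j = 0" if s0: "\<sigma> i * \<sigma> j = 0"
    proof -
      have D: "?D i j = 0" using crit[OF h, of 1 1] degenerate[OF s0] by simp
      have "F i j * (2 * ln 2) = 0"
        using crit[OF h, of 1 2] degenerate[OF s0] D by simp
      then show ?thesis using D by simp
    qed
    have df: "\<sigma> i * \<sigma> j * ?d i j = ?D i j" "\<sigma> i * \<sigma> j * ?f i j = F i j"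
      using DF0 by auto
    have "C i j s t = \<sigma> i * \<sigma> j / 2 *
          (?d i j * (\<bar>s\<bar> + \<bar>t\<bar> - \<bar>s - t\<bar>)
            + ?f i j * (t * ln \<bar>t\<bar> - s * ln \<bar>s\<bar> - (t - s) * ln \<bar>t - s\<bar>))" for s t
    proof -
      have factor: "P / 2 * (x * u + y * v) = (P * x * u + P * y * v) / 2" for P x y u v :: real
        by (simp add: distrib_left mult.assoc)
      show ?thesis unfolding crit[OF h] factor df ..
    qed
    then show "\<sigma> i * \<sigma> j * ?d i j =
          Beta (H $ i + 1 / 2) (H $ j + 1 / 2) *
          ((sin (H $ i * pi) + sin (H $ j * pi)) / 2 * (\<alpha> Ap Ap i j + \<alpha> Am Am i j)
            - \<alpha> Ap Am i j - \<alpha> Am Ap i j) \<and>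
        \<sigma> i * \<sigma> j * ?f i j = (H $ j - H $ i) * (\<alpha> Ap Ap i j - \<alpha> Am Am i j) \<and>
        (\<forall>s t. prob_space.expectation M (\<lambda>\<omega>. X s \<omega> $ i * X t \<omega> $ j) =
          \<sigma> i * \<sigma> j / 2 *
          (?d i j * (\<bar>s\<bar> + \<bar>t\<bar> - \<bar>s - t\<bar>)
            + ?f i j * (t * ln \<bar>t\<bar> - s * ln \<bar>s\<bar> - (t - s) * ln \<bar>t - s\<bar>)))"
      unfolding df C_def[symmetric] by (simp only: critical_coeff_def F_def) blast
  qed
qed

end
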